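(* Let $r$ be a positive integer and let $f\in L_{2\pi}$ be a complex-valued function that has an $r$-th derivative $f^{(r)}\in L_{2\pi}$ (i.e. $f^{(r-1)}$ is absolutely continuous). Let $\hat f(n)$, $n\in\mathbb{Z}$, be the Fourier coefficients of $f$, and suppose that both $\{\hat f(n)\}_{n=0}^{+\infty}\in MVBVS$ and $\{\hat f(-n)\}_{n=0}^{+\infty}\in MVBVS$. Then $$\|f-S_n(f)\|_L=O\left(\frac{1}{(n+1)^r}\,\omega\Big(f^{(r)},\frac1{n+1}\Big)_L\right)\quad(n\to\infty)$$ if and only if $$\hat f(n)\log|n|=O\left(\frac{1}{(|n|+1)^r}\,\omega\Big(f^{(r)},\frac1{|n|+1}\Big)_L\right)\quad(|n|\to\infty).$$
   Context: $L_{2\pi}$ is the space of complex-valued integrable functions of period $2\pi$ with norm $\|f\|_L=\int_{-\pi}^{\pi}|f(x)|\,dx$. The Fourier coefficients of $f$ are $\hat f(k)=\frac1{2\pi}\int_{-\pi}^{\pi}f(x)e^{-ikx}\,dx$, $k\in\mathbb{Z}$, and the partial sums are $S_n(f,x)=\sum_{k=-n}^{n}\hat f(k)e^{ikx}$. $[x]$ denotes the integer part of $x$. The $L^1$ modulus of continuity is $\omega(g,t)_L=\max_{0\le h\le t}\|g(\cdot+h)-g(\cdot)\|_L$. For $\theta\in[0,\pi/2)$ let $K(\theta)=\{z\in\mathbb{C}:|\arg z|\le\theta\}$ (with $0\in K(\theta)$). A complex sequence $\mathbf{c}=\{c_n\}_{n=0}^\infty$ belongs to $MVBVS$ (mean value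 bounded variation sequences) if there is some $\theta_1\in[0,\pi/2)$ with $c_n\in K(\theta_1)$ for all $n\ge 0$, and there are a number $\lambda\ge2$ and a positive constant $C(\mathbf{c})$ depending only on the sequence such that $$\sum_{k=m}^{2m}|c_{k+1}-c_k|\le \frac{C(\mathbf{c})}{m}\sum_{k=[\lambda^{-1}m]}^{[\lambda m]}|c_k|\qquad\text{for all } m=1,2,\dots.$$ *)

theory Defs
  imports "HOL-Analysis.Analysis" "HOL-Library.Landau_Symbols"
begin

definition L2pi :: "(real \<Rightarrow> complex) set" where
  "L2pi = {f. (\<forall>x. f (x + 2 * pi) = f x) \<and> f absolutely_integrable_on {-pi..pi}}"

definition norm_L :: "(real \<Rightarrow> complex) \<Rightarrow> real" where
  "norm_L f = (LINT x:{-pi..pi}|lebesgue. norm (f x))"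

definition fourier_coeff :: "(real \<Rightarrow> complex) \<Rightarrow> int \<Rightarrow> complex" where
  "fourier_coeff f k =
     1 / (2 * pi) * (LINT x:{-pi..pi}|lebesgue. f x * exp (- \<i> * of_int k * of_real x))"

definition fourier_sum :: "nat \<Rightarrow> (real \<Rightarrow> complex) \<Rightarrow> real \<Rightarrow> complex" where
  "fourier_sum n f x = (\<Sum>k = - int n..int n. fourier_coeff f k * exp (\<i> * of_int k * of_real x))"

text \<open>For \<open>g \<in> L2pi\<close> the supremum is attained, translation being continuous in the \<open>L\<close>-norm.\<close>

definition modulus_L :: "(real \<Rightarrow> complex) \<Rightarrow> real \<Rightarrow> real" where
  "modulus_L g t = (SUP h\<in>{0..t}. norm_L (\<lambda>x. g (x + h) - g x))"

text \<open>The usual \<open>\<epsilon>\<close>-\<open>\<delta>\<close> definition: a division is a finite family of nonempty compact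
  intervals \<open>[Inf K, Sup K]\<close> with pairwise disjoint interiors.\<close>

definition abs_continuous_on :: "real set \<Rightarrow> (real \<Rightarrow> complex) \<Rightarrow> bool" where
  "abs_continuous_on S f \<longleftrightarrow>
     (\<forall>\<epsilon>>0. \<exists>\<delta>>0. \<forall>d T. d division_of T \<and> T \<subseteq> S \<and> (\<Sum>K\<in>d. Sup K - Inf K) < \<delta> \<longrightarrow>
        (\<Sum>K\<in>d. norm (f (Sup K) - f (Inf K))) < \<epsilon>)"

text \<open>At a point where the derivative does not exist, \<open>vector_derivative\<close> returns one fixed
  unspecified value, so an almost everywhere defined derivative of a periodic function is a total
  periodic function.\<close>

definition nth_deriv :: "nat \<Rightarrow> (real \<Rightarrow> complex) \<Rightarrow> real \<Rightarrow> complex" where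
  "nth_deriv k = (\<lambda>g x. vector_derivative g (at x)) ^^ k"

text \<open>Meant for \<open>r \<ge> 1\<close>. The derivatives below order \<open>r\<close> exist everywhere, the one of order \<open>r\<close>
  only almost everywhere. The last two clauses already follow from absolute continuity
  and the periodicity of \<open>f\<close>.\<close>

definition has_deriv_in_L :: "nat \<Rightarrow> (real \<Rightarrow> complex) \<Rightarrow> bool" where
  "has_deriv_in_L r f \<longleftrightarrow>
     (\<forall>k<r - 1. \<forall>x. nth_deriv k f differentiable (at x)) \<and>
     (\<forall>a b. abs_continuous_on {a..b} (nth_deriv (r - 1) f)) \<and>
     (AE x in lebesgue. nth_deriv (r - 1) f differentiable (at x)) \<and>
     nth_deriv r f \<in> L2pi"

definition sector :: "real \<Rightarrow> complex set" where
  "sector \<theta> = {z. z = 0 \<or> \<bar>Arg z\<bar> \<le> \<theta>}"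

definition MVBVS :: "(nat \<Rightarrow> complex) set" where
  "MVBVS = {c.
     (\<exists>\<theta>\<in>{0..<pi / 2}. \<forall>n. c n \<in> sector \<theta>) \<and>
     (\<exists>\<Lambda>::real. \<exists>C::real. \<Lambda> \<ge> 2 \<and> C > 0 \<and>
        (\<forall>m\<ge>1. (\<Sum>k = m..2 * m. norm (c (k + 1) - c k)) \<le>
           C / real m * (\<Sum>k = nat \<lfloor>real m / \<Lambda>\<rfloor>..nat \<lfloor>\<Lambda> * real m\<rfloor>. norm (c k))))}"

end

theory Submission imports Defs begin

text \<open>The remainder \<open>f - S\<^sub>n(f)\<close> is compared with the sequence
\<open>\<psi>(n) = (n+1)\<^sup>-\<^sup>r \<omega>(f\<^sup>(\<^sup>r\<^sup>), 1/(n+1))\<close>. Three properties of \<open>\<psi>\<close> drive the proof: it is nonnegative,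
\<open>(n+1) \<psi>(n)\<close> does not increase, and \<open>\<psi>(n)\<close> is comparable to \<open>\<psi>(m)\<close> when \<open>n\<close> and \<open>m\<close> are comparable
(\<open>tame_rate_modulus\<close>). The last one holds because \<open>\<omega>(g, k t) \<le> k \<omega>(g, t)\<close>. The function \<open>f\<close> itself is
continuous, being absolutely continuous or differentiable.

From the remainder to the coefficients. The polynomials \<open>\<Sum>\<^sub>j\<^sub>\<le>\<^sub>n sin(jx)/j\<close> are bounded uniformly in \<open>n\<close>
and \<open>x\<close>. Shifted by \<open>n\<close> frequencies and integrated against \<open>f - S\<^sub>n(f)\<close>, which has no frequency in
\<open>[-n, n]\<close>, they see one side of the spectrum only and give
\<open>\<bar>\<Sum>\<^sub>j\<^sub>\<le>\<^sub>n c\<^sub>n\<^sub>+\<^sub>j/j\<bar> = O(\<parallel>f - S\<^sub>n(f)\<parallel>)\<close> where \<open>c\<^sub>k\<close> is the \<open>k\<close>-th or the \<open>(-k)\<close>-th coefficient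
(\<open>weighted_coeff_sum_le\<close>). Since the \<open>c\<^sub>k\<close> lie in a sector, the same bound holds for
\<open>\<Sum>\<^sub>j\<^sub>\<le>\<^sub>n \<bar>c\<^sub>n\<^sub>+\<^sub>j\<bar>/j\<close>. A single such sum yields no logarithm. Adding those with \<open>N \<le> n \<le> M\<close>, however, every
\<open>\<bar>c\<^sub>k\<bar>\<close> with \<open>2N \<le> k \<le> M\<close> is met with each of the weights \<open>1, 1/2, \<dots>, 1/N\<close>, so that the mean of \<open>\<bar>c\<^sub>k\<bar>\<close> over
\<open>[2N, M]\<close> is \<open>O(\<psi>(N) / log N)\<close> when \<open>M\<close> is a bounded multiple of \<open>N\<close> (\<open>sum_times_harm_le\<close>). The mean value
bounded variation condition dominates a single \<open>\<bar>c\<^sub>n\<bar>\<close> by such a mean (\<open>MVBVS_log_decay\<close>).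

From the coefficients to the remainder. Summation by parts and the bound \<open>O(log n)\<close> for the
\<open>L\<close>-norm of the Dirichlet kernel reduce each half of the block \<open>S\<^sub>2\<^sub>n(f) - S\<^sub>n(f)\<close> to \<open>log n\<close> times the variation of the
coefficients over \<open>[n, 2n]\<close> plus a boundary term (\<open>norm_L_one_sided_block\<close>), and this is \<open>O(\<psi>(n))\<close> by the
mean value bounded variation condition (\<open>MVBVS_variation_bound\<close>). As \<open>\<psi>(2\<^sup>jn) \<le> 2 \<cdot> 2\<^sup>-\<^sup>j \<psi>(n)\<close> for \<open>n \<ge> 1\<close>, the dyadic
blocks add up to \<open>O(\<psi>(n))\<close> like a geometric series, uniformly in their number. Finally a bound on \<open>\<parallel>S\<^sub>m(f) - S\<^sub>n(f)\<parallel>\<close> for arbitrarily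
large \<open>m\<close> passes to \<open>\<parallel>f - S\<^sub>n(f)\<parallel>\<close> by duality with trigonometric polynomials
(\<open>norm_L_le_frequently_partial_sums\<close>).\<close>

section \<open>Translation and the modulus of continuity\<close>

lemma norm_L_eq_integral:
  assumes "f absolutely_integrable_on {-pi..pi}"
  shows "norm_L f = integral {-pi..pi} (\<lambda>x. norm (f x))"
  unfolding norm_L_def
  by (rule set_lebesgue_integral_eq_integral(2)) (use assms in \<open>rule set_integrable_norm\<close>)

lemma norm_L_nonneg: "norm_L f \<ge> 0"
  unfolding norm_L_def set_lebesgue_integral_def by (rule integral_nonneg_AE) auto

lemma L2pi_absolutely_integrable: "f \<in> L2pi \<Longrightarrow> f absolutely_integrable_on {-pi..pi}"
  by (simp add: L2pi_def)

lemma L2pi_diff: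
  assumes "f \<in> L2pi" "g \<in> L2pi"
  shows "(\<lambda>x. f x - g x) \<in> L2pi"
  using assms by (simp add: L2pi_def set_integral_diff)

lemma norm_L_add_le:
  assumes "f absolutely_integrable_on {-pi..pi}" "g absolutely_integrable_on {-pi..pi}"
  shows "norm_L (\<lambda>x. f x + g x) \<le> norm_L f + norm_L g"
proof -
  have sum: "(\<lambda>x. f x + g x) absolutely_integrable_on {-pi..pi}"
    by (rule set_integral_add(1)[OF assms])
  with assms have "norm_L (\<lambda>x. f x + g x) \<le> integral {-pi..pi} (\<lambda>x. norm (f x) + norm (g x))"
    unfolding norm_L_eq_integral[OF sum]
    by (intro integral_le norm_triangle_ineq integrable_add)
       (auto simp: absolutely_integrable_on_def)
  also have "\<dots> = norm_L f + norm_L g"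
    using assms by (simp add: norm_L_eq_integral integral_add absolutely_integrable_on_def)
  finally show ?thesis .
qed

lemma norm_L_uminus: "norm_L (\<lambda>x. - f x) = norm_L f"
  by (simp add: norm_L_def)

lemma norm_L_diff_le:
  assumes "f \<in> L2pi" "g \<in> L2pi"
  shows "norm_L (\<lambda>x. f x - g x) \<le> norm_L f + norm_L g"
proof -
  have "(\<lambda>x. - g x) \<in> L2pi"
    using L2pi_diff[OF _ assms(2), of "\<lambda>x. 0"] by (simp add: L2pi_def)
  with assms have "norm_L (\<lambda>x. f x + - g x) \<le> norm_L f + norm_L (\<lambda>x. - g x)"
    by (intro norm_L_add_le L2pi_absolutely_integrable)
  then show ?thesis by (simp add: norm_L_uminus)
qed

text \<open>The interval \<open>[h - \<pi>, h + \<pi>]\<close> is \<open>[-\<pi>, \<pi>]\<close> with its left piece of length \<open>h\<close> moved by one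
period to the right end.\<close>

lemma periodic_has_integral_shift:
  fixes f :: "real \<Rightarrow> 'a::banach"
  assumes per: "\<And>x. f (x + 2 * pi) = f x"
    and I: "(f has_integral I) {-pi..pi}" and h: "0 \<le> h" "h \<le> 2 * pi"
  shows "((\<lambda>x. f (x + h)) has_integral I) {-pi..pi}"
proof -
  have int: "f integrable_on {-pi..pi}" using I by blast
  have "(f has_integral integral {-pi..h - pi} f) {-pi..h - pi}"
    using int h by (intro integrable_integral) (auto elim: integrable_subinterval_real)
  from has_integral_shift_real_ivl[OF this, of "- 2 * pi"]
  have "((\<lambda>x. f (x - 2 * pi)) has_integral integral {-pi..h - pi} f) {pi..h + pi}"
    by (simp add: algebra_simps)
  moreover have "f (x - 2 * pi) = f x" for x
    using per[of "x - 2 * pi"] by simp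
  ultimately have right: "(f has_integral integral {-pi..h - pi} f) {pi..h + pi}"
    by simp
  have left: "(f has_integral integral {h - pi..pi} f) {h - pi..pi}"
    using int h by (intro integrable_integral) (auto elim: integrable_subinterval_real)
  have "(f has_integral integral {h - pi..pi} f + integral {-pi..h - pi} f) {h - pi..h + pi}"
    using has_integral_combine[OF _ _ left right] h by simp
  also have "integral {h - pi..pi} f + integral {-pi..h - pi} f = I"
    using Henstock_Kurzweil_Integration.integral_combine[OF _ _ int, of "h - pi"] h integral_unique[OF I] by (simp add: add.commute)
  finally show ?thesis
    using has_integral_shift_real_ivl[of f I "h - pi" "h + pi" h] by simp
qed

lemma periodic_reduce:
  fixes f :: "real \<Rightarrow> 'a"
  assumes per: "\<And>x. f (x + 2 * pi) = f x"
  obtains h' where "0 \<le> h'" "h' \<le> 2 * pi" "\<And>x. f (x + h) = f (x + h')"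
proof
  interpret periodic_fun_simple f "2 * pi"
    by standard (rule per)
  let ?h = "2 * pi * frac (h / (2 * pi))"
  show "0 \<le> ?h" by simp
  show "?h \<le> 2 * pi"
    using frac_lt_1[of "h / (2 * pi)"] mult_left_mono[of "frac (h / (2 * pi))" 1 "2 * pi"] by simp
  have "h = ?h + of_int \<lfloor>h / (2 * pi)\<rfloor> * (2 * pi)"
    by (simp add: frac_def field_simps)
  then have "x + h = x + ?h + of_int \<lfloor>h / (2 * pi)\<rfloor> * (2 * pi)" for x
    by linarith
  then show "f (x + h) = f (x + ?h)" for x
    by (metis plus_of_int)
qed

lemma L2pi_shift:
  assumes "f \<in> L2pi"
  shows "(\<lambda>x. f (x + h)) \<in> L2pi" and "norm_L (\<lambda>x. f (x + h)) = norm_L f"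
proof -
  have per: "f (x + 2 * pi) = f x" for x using assms by (simp add: L2pi_def)
  obtain h' where h': "0 \<le> h'" "h' \<le> 2 * pi" "\<And>x. f (x + h) = f (x + h')"
    using periodic_reduce[of f h, OF per] by blast
  have f: "(f has_integral integral {-pi..pi} f) {-pi..pi}"
    and nf: "((\<lambda>x. norm (f x)) has_integral norm_L f) {-pi..pi}"
    using L2pi_absolutely_integrable[OF assms]
    by (auto simp: norm_L_eq_integral absolutely_integrable_on_def intro: integrable_integral)
  note shifts = periodic_has_integral_shift[OF per f h'(1,2)]
    periodic_has_integral_shift[OF _ nf h'(1,2)]
  from shifts have ai: "(\<lambda>x. f (x + h)) absolutely_integrable_on {-pi..pi}"
    by (auto simp: h'(3) per absolutely_integrable_on_def)
  moreover have "f (x + 2 * pi + h) = f (x + h)" for x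
    using per[of "x + h"] by (simp add: algebra_simps)
  ultimately show "(\<lambda>x. f (x + h)) \<in> L2pi" by (simp add: L2pi_def)
  show "norm_L (\<lambda>x. f (x + h)) = norm_L f"
    using integral_unique[OF shifts(2)] per by (simp only: norm_L_eq_integral[OF ai] flip: h'(3))
qed

lemma bdd_above_modulus_L:
  assumes "g \<in> L2pi"
  shows "bdd_above ((\<lambda>h. norm_L (\<lambda>x. g (x + h) - g x)) ` S)"
proof (intro bdd_aboveI2)
  show "norm_L (\<lambda>x. g (x + h) - g x) \<le> 2 * norm_L g" for h
    using norm_L_diff_le[OF L2pi_shift(1)[OF assms, of h] assms] L2pi_shift(2)[OF assms] by simp
qed

lemma modulus_L_upper:
  assumes "g \<in> L2pi" "0 \<le> h" "h \<le> t"
  shows "norm_L (\<lambda>x. g (x + h) - g x) \<le> modulus_L g t"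
  unfolding modulus_L_def using assms bdd_above_modulus_L by (intro cSUP_upper) auto

lemma modulus_L_nonneg:
  assumes "g \<in> L2pi" "0 \<le> t"
  shows "0 \<le> modulus_L g t"
  using modulus_L_upper[OF assms(1), of 0 t] norm_L_nonneg[of "\<lambda>x. g (x + 0) - g x"] assms(2)
  by linarith

lemma modulus_L_mono:
  assumes "g \<in> L2pi" "0 \<le> s" "s \<le> t"
  shows "modulus_L g s \<le> modulus_L g t"
  unfolding modulus_L_def using assms bdd_above_modulus_L
  by (intro cSUP_subset_mono) auto

text \<open>The difference over \<open>k h\<close> telescopes into \<open>k\<close> translates of the difference over \<open>h\<close>, which all
have the same norm. With it the modulus grows at most linearly (\<open>modulus_L_multiple\<close>), the source of the
doubling property of comparison sequences.\<close>

lemma norm_L_multiple_shift: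
  assumes "g \<in> L2pi"
  shows "norm_L (\<lambda>x. g (x + real k * h) - g x) \<le> real k * norm_L (\<lambda>x. g (x + h) - g x)"
proof (induction k)
  case 0
  then show ?case by (simp add: norm_L_def)
next
  case (Suc k)
  note sh = L2pi_shift(1)[OF assms]
  let ?d = "\<lambda>x. g (x + h) - g x"
  have d: "?d \<in> L2pi" by (intro L2pi_diff sh assms)
  have "norm_L (\<lambda>x. g (x + real (Suc k) * h) - g x)
      = norm_L (\<lambda>x. ?d (x + real k * h) + (g (x + real k * h) - g x))"
    by (simp add: algebra_simps)
  also have "\<dots> \<le> norm_L (\<lambda>x. ?d (x + real k * h)) + norm_L (\<lambda>x. g (x + real k * h) - g x)"
    by (intro norm_L_add_le L2pi_absolutely_integrable L2pi_shift(1)[OF d] L2pi_diff sh assms)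
  also have "norm_L (\<lambda>x. ?d (x + real k * h)) = norm_L ?d"
    by (rule L2pi_shift(2)[OF d])
  finally show ?case using Suc by (simp add: algebra_simps)
qed

lemma modulus_L_multiple:
  assumes "g \<in> L2pi" "0 \<le> t"
  shows "modulus_L g (real k * t) \<le> real k * modulus_L g t"
proof (cases "k = 0")
  case True
  then show ?thesis by (simp add: modulus_L_def norm_L_def)
next
  case False
  show ?thesis unfolding modulus_L_def[of g "real k * t"]
  proof (rule cSUP_least)
    fix h assume h: "h \<in> {0..real k * t}"
    have "norm_L (\<lambda>x. g (x + h) - g x) \<le> real k * norm_L (\<lambda>x. g (x + h / real k) - g x)"
      using norm_L_multiple_shift[OF assms(1), of k "h / real k"] False by simp
    also have "\<dots> \<le> real k * modulus_L g t"
      using h False by (intro mult_left_mono modulus_L_upper[OF assms(1)]) (auto simp: field_simps)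
    finally show "norm_L (\<lambda>x. g (x + h) - g x) \<le> real k * modulus_L g t" .
  qed (use assms False in auto)
qed

section \<open>Comparison sequences\<close>

text \<open>The second clause gives geometric decay along \<open>n, 2n, 4n, \<dots>\<close>; the third compares the values at
indices of bounded ratio. The shift \<open>n + 1\<close> lets index \<open>0\<close> take part.\<close>

definition tame_rate :: "(nat \<Rightarrow> real) \<Rightarrow> bool" where
  "tame_rate \<psi> \<longleftrightarrow> (\<forall>n. 0 \<le> \<psi> n) \<and>
     (\<forall>n m. n \<le> m \<longrightarrow> (real m + 1) * \<psi> m \<le> (real n + 1) * \<psi> n) \<and>
     (\<forall>L. \<exists>K\<ge>0. \<forall>n m. m + 1 \<le> L * (n + 1) \<longrightarrow> \<psi> n \<le> K * \<psi> m)"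

lemma tame_rate_decreasing:
  assumes "tame_rate \<psi>" "n \<le> m"
  shows "\<psi> m \<le> \<psi> n"
proof -
  have "(real n + 1) * \<psi> m \<le> (real m + 1) * \<psi> m"
    using assms by (intro mult_right_mono) (auto simp: tame_rate_def)
  also have "\<dots> \<le> (real n + 1) * \<psi> n"
    using assms by (auto simp: tame_rate_def)
  finally show ?thesis by (simp add: mult_le_cancel_left_pos)
qed

text \<open>One factor \<open>1 / (n + 1)\<close> out of the \<open>r \<ge> 1\<close> is spent on the monotonicity of \<open>(n + 1) \<psi>(n)\<close>; the
remaining ones and the modulus decrease by themselves.\<close>

lemma tame_rate_modulus:
  assumes g: "g \<in> L2pi" and r: "r \<ge> 1"
  shows "tame_rate (\<lambda>n. 1 / (real n + 1) ^ r * modulus_L g (1 / (real n + 1)))"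
  unfolding tame_rate_def
proof (intro conjI allI impI)
  let ?\<psi> = "\<lambda>n. 1 / (real n + 1) ^ r * modulus_L g (1 / (real n + 1))"
  show "0 \<le> ?\<psi> n" for n
    by (intro mult_nonneg_nonneg modulus_L_nonneg[OF g]) auto
  show "(real m + 1) * ?\<psi> m \<le> (real n + 1) * ?\<psi> n" if "n \<le> m" for n m
  proof -
    obtain q where q: "r = Suc q" using r by (cases r) auto
    have eq: "(real k + 1) * ?\<psi> k = 1 / (real k + 1) ^ q * modulus_L g (1 / (real k + 1))" for k
    proof -
      have "1 + real k \<noteq> 0" by linarith
      then show ?thesis by (simp add: q add.commute)
    qed
    show ?thesis unfolding eq using that
      by (intro mult_mono modulus_L_mono[OF g] modulus_L_nonneg[OF g] divide_left_mono power_mono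
            mult_pos_pos zero_less_power)
         (auto simp: field_simps)
  qed
  show "\<exists>K\<ge>0. \<forall>n m. m + 1 \<le> L * (n + 1) \<longrightarrow> ?\<psi> n \<le> K * ?\<psi> m" for L
  proof (intro exI[of _ "real L ^ r * real L"] conjI allI impI)
    fix n m assume "m + 1 \<le> L * (n + 1)"
    then have le: "real m + 1 \<le> real L * (real n + 1)"
      by (metis of_nat_1 of_nat_add of_nat_le_iff of_nat_mult)
    have "1 / (real n + 1) ^ r \<le> real L ^ r * (1 / (real m + 1) ^ r)"
    proof -
      have "(real m + 1) ^ r \<le> real L ^ r * (real n + 1) ^ r"
        using power_mono[OF le, of r] by (simp add: power_mult_distrib)
      then show ?thesis by (simp add: field_simps)
    qed
    moreover have "modulus_L g (1 / (real n + 1)) \<le> real L * modulus_L g (1 / (real m + 1))"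
      using le by (intro order.trans[OF modulus_L_mono[OF g] modulus_L_multiple[OF g]])
        (auto simp: field_simps)
    ultimately have "?\<psi> n \<le> (real L ^ r * (1 / (real m + 1) ^ r)) * (real L * modulus_L g (1 / (real m + 1)))"
      by (intro mult_mono modulus_L_nonneg[OF g]) auto
    then show "?\<psi> n \<le> (real L ^ r * real L) * ?\<psi> m" by (simp add: mult_ac)
  qed auto
qed

section \<open>Exponentials and Fourier coefficients of continuous functions\<close>

definition trig :: "int \<Rightarrow> real \<Rightarrow> complex" where
  "trig k x = exp (\<i> * of_int k * of_real x)"

lemma trig_0 [simp]: "trig 0 x = 1"
  by (simp add: trig_def)

lemma trig_add: "trig (j + k) x = trig j x * trig k x"
  by (simp add: trig_def exp_add[symmetric] algebra_simps)

lemma norm_trig [simp]: "norm (trig k x) = 1"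
proof -
  have "trig k x = exp (\<i> * of_real (of_int k * x))" by (simp add: trig_def mult.assoc)
  then show ?thesis by (simp only: norm_exp_i_times)
qed

lemma trig_of_nat: "trig (int n) x = trig 1 x ^ n"
  by (simp add: trig_def exp_of_nat_mult[symmetric] mult_ac)

lemma continuous_on_trig [continuous_intros]: "continuous_on S (trig k)"
  unfolding trig_def by (intro continuous_intros)

lemma trig_periodic: "trig k (x + 2 * pi) = trig k x"
proof -
  have "trig k (x + 2 * pi) = trig k x * exp (2 * of_int k * of_real pi * \<i>)"
    by (simp add: trig_def exp_add[symmetric] algebra_simps)
  then show ?thesis using exp_integer_2pi[of "of_int k"] by simp
qed

lemma sin_eq_trig: "complex_of_real (sin (of_int k * x)) = (trig k x - trig (- k) x) / (2 * \<i>)"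
  using sin_exp_eq[of "of_int k * of_real x"]
  by (simp add: trig_def mult.assoc flip: sin_of_real)

lemma integral_trig: "integral {-pi..pi} (trig k) = (if k = 0 then 2 * pi else 0)"
proof (cases "k = 0")
  case True
  then have "trig k = (\<lambda>_. 1)" by (simp add: fun_eq_iff)
  then show ?thesis using True by (simp add: scaleR_conv_of_real)
next
  case False
  define F where "F = (\<lambda>x. trig k x / (\<i> * of_int k))"
  have "(F has_vector_derivative trig k x) (at x within {-pi..pi})" for x
    unfolding F_def trig_def using False
    by (auto intro!: derivative_eq_intros has_vector_derivative_real_field)
  then have "(trig k has_integral F pi - F (-pi)) {-pi..pi}"
    by (intro fundamental_theorem_of_calculus) auto
  moreover have "F pi = F (-pi)"
    using trig_periodic[of k "-pi"] by (simp add: F_def)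
  ultimately show ?thesis using False by (simp add: integral_unique)
qed

lemma continuous_integrable: "continuous_on UNIV f \<Longrightarrow> f integrable_on {a..b}"
  for f :: "real \<Rightarrow> 'a::euclidean_space"
  by (meson continuous_on_subset integrable_continuous_real subset_UNIV)

lemma continuous_absolutely_integrable:
  "continuous_on UNIV f \<Longrightarrow> f absolutely_integrable_on {a..b}"
  for f :: "real \<Rightarrow> 'a::euclidean_space"
  by (meson continuous_on_subset absolutely_integrable_continuous_real subset_UNIV)

lemma norm_L_continuous:
  "continuous_on UNIV f \<Longrightarrow> norm_L f = integral {-pi..pi} (\<lambda>x. norm (f x))"
  by (intro norm_L_eq_integral continuous_absolutely_integrable)

lemma norm_L_mono:
  assumes "continuous_on UNIV f" "h integrable_on {-pi..pi}"
    and "\<And>x. x \<in> {-pi..pi} \<Longrightarrow> norm (f x) \<le> h x"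
  shows "norm_L f \<le> integral {-pi..pi} h"
  unfolding norm_L_continuous[OF assms(1)]
  by (intro integral_le continuous_integrable assms continuous_on_norm)

lemma fourier_coeff_continuous:
  assumes "continuous_on UNIV f"
  shows "fourier_coeff f k = integral {-pi..pi} (\<lambda>x. f x * trig (- k) x) / (2 * pi)"
proof -
  have "(LINT x:{-pi..pi}|lebesgue. f x * trig (- k) x) = integral {-pi..pi} (\<lambda>x. f x * trig (- k) x)"
    by (intro set_lebesgue_integral_eq_integral(2) continuous_absolutely_integrable
        continuous_intros assms)
  then show ?thesis by (simp add: fourier_coeff_def trig_def)
qed

lemma fourier_sum_eq: "fourier_sum n f x = (\<Sum>k = - int n..int n. fourier_coeff f k * trig k x)"
  by (simp add: fourier_sum_def trig_def)

lemma continuous_fourier_sum: "continuous_on S (fourier_sum n f)"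
  unfolding fourier_sum_eq[abs_def] by (intro continuous_intros)

lemma integral_mult_trig_sum:
  assumes g: "continuous_on UNIV g" and A: "finite A"
  shows "integral {-pi..pi} (\<lambda>x. g x * (\<Sum>k\<in>A. p k * trig k x))
       = 2 * pi * (\<Sum>k\<in>A. p k * fourier_coeff g (- k))"
proof -
  have "integral {-pi..pi} (\<lambda>x. g x * (\<Sum>k\<in>A. p k * trig k x))
      = integral {-pi..pi} (\<lambda>x. \<Sum>k\<in>A. p k * (g x * trig k x))"
    by (simp add: sum_distrib_left mult_ac)
  also have "\<dots> = (\<Sum>k\<in>A. p k * integral {-pi..pi} (\<lambda>x. g x * trig k x))"
    by (subst integral_sum) (auto intro!: A continuous_integrable continuous_intros g)
  also have "\<dots> = 2 * pi * (\<Sum>k\<in>A. p k * fourier_coeff g (- k))"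
    by (simp add: fourier_coeff_continuous[OF g] sum_distrib_left)
  finally show ?thesis .
qed

lemma fourier_coeff_diff:
  assumes "continuous_on UNIV f" "continuous_on UNIV g"
  shows "fourier_coeff (\<lambda>x. f x - g x) k = fourier_coeff f k - fourier_coeff g k"
  using assms
  by (simp add: fourier_coeff_continuous continuous_on_diff left_diff_distrib
        integral_diff continuous_integrable continuous_on_mult continuous_on_trig diff_divide_distrib)

lemma fourier_coeff_fourier_sum:
  "fourier_coeff (fourier_sum n f) k = (if \<bar>k\<bar> \<le> int n then fourier_coeff f k else 0)"
proof -
  have cont: "continuous_on UNIV (trig (- k))" by (rule continuous_on_trig)
  have c1: "fourier_coeff (trig (- k)) (- j) = (if j = k then 1 else 0)" for j
    by (simp add: fourier_coeff_continuous continuous_on_trig trig_add[symmetric] integral_trig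
        cong: if_cong)
  have "fourier_coeff (fourier_sum n f) k
      = integral {-pi..pi} (\<lambda>x. trig (- k) x * (\<Sum>j = - int n..int n. fourier_coeff f j * trig j x)) / (2 * pi)"
    by (simp add: fourier_coeff_continuous[OF continuous_fourier_sum] fourier_sum_eq mult.commute)
  also have "\<dots> = (\<Sum>j = - int n..int n. fourier_coeff f j * (if j = k then 1 else 0))"
    by (subst integral_mult_trig_sum[OF cont]) (simp_all add: c1)
  also have "\<dots> = (if \<bar>k\<bar> \<le> int n then fourier_coeff f k else 0)"
    by (auto simp: if_distrib sum.delta abs_le_iff cong: if_cong)
  finally show ?thesis .
qed

section \<open>The Dirichlet kernel and summation by parts\<close>

text \<open>Jordan's inequality: by concavity the sine lies above its chord on \<open>[0, \<pi>/2]\<close>.\<close>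

lemma sin_lower_bound:
  assumes "0 \<le> x" "x \<le> pi / 2"
  shows "2 * x / pi \<le> sin x"
proof -
  have "concave_on {0..pi} (sin :: real \<Rightarrow> real)"
    by (rule f''_le0_imp_concave[where f' = cos and f'' = "\<lambda>x. - sin x"])
       (auto intro!: derivative_eq_intros sin_ge_zero)
  from concave_onD[OF this, of "2 * x / pi" 0 "pi / 2"] show ?thesis
    using assms by (simp add: field_simps)
qed

text \<open>The sum is geometric, with numerator at most \<open>2\<close> and denominator \<open>\<bar>e\<^sup>i\<^sup>x - 1\<bar> = 2 \<bar>sin (x/2)\<bar>\<close>, at
least \<open>2 \<bar>x\<bar> / \<pi>\<close> by Jordan's inequality. The product form includes \<open>x = 0\<close>.\<close>

lemma sum_trig_bound:
  assumes "\<bar>x\<bar> \<le> pi"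
  shows "norm (\<Sum>i<k. trig (int i) x) * \<bar>x\<bar> \<le> pi"
proof -
  let ?D = "\<Sum>i<k. trig (int i) x"
  have "?D * (trig 1 x - 1) = trig 1 x ^ k - 1"
    by (simp add: trig_of_nat power_diff_1_eq mult.commute)
  then have "norm ?D * norm (trig 1 x - 1) = norm (trig 1 x ^ k - 1)"
    by (metis norm_mult)
  also have "\<dots> \<le> norm (trig 1 x ^ k) + norm (1::complex)" by (rule norm_triangle_ineq4)
  finally have le2: "norm ?D * norm (trig 1 x - 1) \<le> 2" by (simp add: norm_power)
  have "2 * (\<bar>x\<bar> / 2) / pi \<le> sin (\<bar>x\<bar> / 2)" using assms by (intro sin_lower_bound) auto
  also have "sin (\<bar>x\<bar> / 2) = sgn x * sin (x / 2)" by (simp add: sgn_if abs_if)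
  also have "\<dots> \<le> \<bar>sin (x / 2)\<bar>" by (simp add: sgn_if abs_if)
  also have "\<dots> = norm (trig 1 x - 1) / 2"
    by (simp add: trig_def dist_exp_i_1)
  finally have "\<bar>x\<bar> \<le> norm (trig 1 x - 1) * pi / 2" by (simp add: field_simps)
  then have "norm ?D * \<bar>x\<bar> \<le> norm ?D * (norm (trig 1 x - 1) * pi / 2)"
    by (intro mult_left_mono) auto
  also have "\<dots> = (norm ?D * norm (trig 1 x - 1)) * (pi / 2)" by simp
  also have "\<dots> \<le> 2 * (pi / 2)" using le2 by (intro mult_right_mono) auto
  finally show ?thesis by simp
qed

lemma abel_summation:
  fixes c e :: "nat \<Rightarrow> 'a::comm_ring"
  shows "(\<Sum>i<k. c i * e i) = c k * (\<Sum>i<k. e i) + (\<Sum>i<k. (c i - c (Suc i)) * (\<Sum>j<Suc i. e j))"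
  by (induction k) (simp_all add: algebra_simps)

lemma abel_bound:
  fixes c e :: "nat \<Rightarrow> complex"
  shows "norm (\<Sum>i<k. c i * e i) \<le> norm (c k) * norm (\<Sum>i<k. e i)
           + (\<Sum>i<k. norm (c (Suc i) - c i) * norm (\<Sum>j<Suc i. e j))"
proof -
  have "norm (\<Sum>i<k. (c i - c (Suc i)) * (\<Sum>j<Suc i. e j))
      \<le> (\<Sum>i<k. norm (c (Suc i) - c i) * norm (\<Sum>j<Suc i. e j))"
    by (intro order.trans[OF norm_sum] sum_mono) (simp add: norm_mult norm_minus_commute)
  moreover have "norm (c k * (\<Sum>i<k. e i)) = norm (c k) * norm (\<Sum>i<k. e i)"
    by (rule norm_mult)
  ultimately show ?thesis
    unfolding abel_summation[of c e k]
    by (intro order.trans[OF norm_triangle_ineq]) linarith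
qed

text \<open>The kernel is at most \<open>min k (\<pi> / \<bar>x\<bar>)\<close>, hence at most the smooth majorant
\<open>2 \<pi> k / (k \<bar>x\<bar> + \<pi>)\<close>, whose primitive on \<open>[0, \<pi>]\<close> is an explicit logarithm; this avoids cutting the
integral at \<open>1 / k\<close>.\<close>

lemma norm_L_sum_trig:
  "norm_L (\<lambda>x. \<Sum>i<k. trig (int i) x) \<le> 4 * pi * ln (real k + 1)"
proof -
  define w where "w = (\<lambda>x. 2 * pi * real k / (real k * x + pi))"
  have ge: "0 < real k * x + pi" if "0 \<le> x" for x
    using that by (simp add: add_nonneg_pos)
  have W: "((\<lambda>x. 2 * pi * ln (real k * x + pi)) has_vector_derivative w x) (at x within {0..pi})"
    if "x \<in> {0..pi}" for x
    unfolding w_def has_real_derivative_iff_has_vector_derivative[symmetric]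
    using ge[of x] that by (auto intro!: derivative_eq_intros simp: field_simps)
  have "(w has_integral 2 * pi * ln (real k * pi + pi) - 2 * pi * ln (real k * 0 + pi)) {0..pi}"
    using W by (intro fundamental_theorem_of_calculus) auto
  also have "2 * pi * ln (real k * pi + pi) - 2 * pi * ln (real k * 0 + pi) = 2 * pi * ln (real k + 1)"
    using ln_mult[of "real k + 1" pi] by (simp add: algebra_simps)
  finally have right: "(w has_integral 2 * pi * ln (real k + 1)) {0..pi}" .
  then have right': "((\<lambda>x. w \<bar>x\<bar>) has_integral 2 * pi * ln (real k + 1)) {0..pi}"
    by (rule has_integral_eq[rotated]) auto
  then have left': "((\<lambda>x. w \<bar>x\<bar>) has_integral 2 * pi * ln (real k + 1)) {-pi..0}"
    using has_integral_reflect_real[of "\<lambda>x. w \<bar>x\<bar>" _ pi 0] by simp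
  from has_integral_combine[OF _ _ left' right']
  have int: "((\<lambda>x. w \<bar>x\<bar>) has_integral 4 * pi * ln (real k + 1)) {-pi..pi}"
    by (simp add: mult.assoc)
  have "norm_L (\<lambda>x. \<Sum>i<k. trig (int i) x) \<le> integral {-pi..pi} (\<lambda>x. w \<bar>x\<bar>)"
  proof (intro norm_L_mono continuous_intros)
    show "(\<lambda>x. w \<bar>x\<bar>) integrable_on {-pi..pi}" using int by blast
    fix x assume x: "x \<in> {-pi..pi}"
    let ?D = "\<Sum>i<k. trig (int i) x"
    have "norm ?D \<le> (\<Sum>i<k. norm (trig (int i) x))" by (rule norm_sum)
    then have "norm ?D \<le> real k" by simp
    then have "norm ?D * pi \<le> real k * pi" by simp
    moreover have "real k * (norm ?D * \<bar>x\<bar>) \<le> real k * pi"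
      using sum_trig_bound[of x k] x by (intro mult_left_mono) auto
    moreover have "norm ?D * (real k * \<bar>x\<bar> + pi) = norm ?D * pi + real k * (norm ?D * \<bar>x\<bar>)"
      by (simp add: algebra_simps)
    ultimately have "norm ?D * (real k * \<bar>x\<bar> + pi) \<le> 2 * (real k * pi)"
      by linarith
    then show "norm ?D \<le> w \<bar>x\<bar>"
      using ge[of "\<bar>x\<bar>"] by (simp add: w_def pos_le_divide_eq mult_ac)
  qed
  then show ?thesis using int by (simp add: integral_unique)
qed

section \<open>Bounded sine sums and one-sided coefficient sums\<close>

lemma abs_sin_mult_le: "\<bar>sin (real j * x)\<bar> \<le> real j * \<bar>x\<bar>"
  using abs_sin_x_le_abs_x[of "real j * x"] by (simp add: abs_mult)

text \<open>The weights decrease, so summation by parts bounds the sum by its first weight times the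
uniform bound \<open>\<pi> / \<bar>x\<bar>\<close> on the partial sums of the exponentials.\<close>

lemma sine_tail_bound:
  assumes x: "x \<noteq> 0" "\<bar>x\<bar> \<le> pi"
  shows "\<bar>\<Sum>i<k. sin (real (M + 1 + i) * x) / real (M + 1 + i)\<bar> \<le> pi / \<bar>x\<bar> / (real M + 1)"
proof -
  define c :: "nat \<Rightarrow> complex" where "c = (\<lambda>i. of_real (1 / real (M + 1 + i)))"
  let ?Z = "\<Sum>i<k. c i * trig (int i) x"
  have B: "norm (\<Sum>j<i. trig (int j) x) \<le> pi / \<bar>x\<bar>" for i
    using sum_trig_bound[OF x(2), of i] x(1) by (simp add: field_simps)
  have "(\<Sum>i<k. sin (real (M + 1 + i) * x) / real (M + 1 + i)) = Im (trig (int (M + 1)) x * ?Z)"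
  proof -
    have "trig (int (M + 1)) x * ?Z = (\<Sum>i<k. of_real (1 / real (M + 1 + i)) * trig (int (M + 1 + i)) x)"
      unfolding sum_distrib_left of_nat_add[of "M + 1"] trig_add c_def by (simp add: mult_ac)
    moreover have "Im (of_real r * trig (int j) x) = r * sin (real j * x)" for r j
      by (simp add: trig_def Im_exp)
    ultimately show ?thesis by (simp only: Im_sum) simp
  qed
  also have "\<bar>\<dots>\<bar> \<le> norm (trig (int (M + 1)) x * ?Z)" by (rule abs_Im_le_cmod)
  also have "\<dots> = norm ?Z" by (simp only: norm_mult norm_trig mult_1)
  also have "\<dots> \<le> norm (c k) * norm (\<Sum>i<k. trig (int i) x)
      + (\<Sum>i<k. norm (c (Suc i) - c i) * norm (\<Sum>j<Suc i. trig (int j) x))"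
    by (rule abel_bound)
  also have "\<dots> \<le> norm (c k) * (pi / \<bar>x\<bar>) + (\<Sum>i<k. norm (c (Suc i) - c i) * (pi / \<bar>x\<bar>))"
    by (intro add_mono mult_left_mono sum_mono B) auto
  also have "\<dots> = (pi / \<bar>x\<bar>) * (norm (c k) + (\<Sum>i<k. norm (c (Suc i) - c i)))"
    by (simp add: sum_distrib_left algebra_simps)
  also have "norm (c k) + (\<Sum>i<k. norm (c (Suc i) - c i)) = 1 / (real M + 1)"
  proof -
    have "norm (c (Suc i) - c i) = 1 / real (M + 1 + i) - 1 / real (M + 1 + Suc i)" for i
    proof -
      have "norm (c (Suc i) - c i) = \<bar>1 / real (M + 1 + Suc i) - 1 / real (M + 1 + i)\<bar>"
        unfolding c_def of_real_diff[symmetric] norm_of_real ..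
      moreover have "1 / real (M + 1 + Suc i) \<le> 1 / real (M + 1 + i)"
        by (intro divide_left_mono) auto
      ultimately show ?thesis by linarith
    qed
    then have "(\<Sum>i<k. norm (c (Suc i) - c i)) = 1 / real (M + 1) - 1 / real (M + 1 + k)"
      using sum_lessThan_telescope'[of "\<lambda>i. 1 / real (M + 1 + i)" k] by simp
    moreover have "norm (c k) = 1 / real (M + 1 + k)" unfolding c_def norm_of_real by simp
    ultimately show ?thesis by simp
  qed
  finally show ?thesis by simp
qed

text \<open>Up to \<open>j \<approx> 1 / \<bar>x\<bar>\<close> each term is at most \<open>\<bar>x\<bar>\<close>, so these terms contribute at most \<open>1\<close>; beyond that point
the cancellation in the tail leaves at most \<open>\<pi>\<close>.\<close>

lemma sine_sum_bounded:
  assumes "\<bar>x\<bar> \<le> pi"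
  shows "\<bar>\<Sum>j = 1..n. sin (real j * x) / real j\<bar> \<le> 1 + pi"
proof (cases "x = 0")
  case False
  \<comment> \<open>the two bounds balance here: \<open>M \<bar>x\<bar> \<le> 1 < (M + 1) \<bar>x\<bar>\<close>\<close>
  define M where "M = nat \<lfloor>1 / \<bar>x\<bar>\<rfloor>"
  have "real M \<le> 1 / \<bar>x\<bar>" by (simp add: M_def)
  then have M1: "real M * \<bar>x\<bar> \<le> 1" using False by (simp add: field_simps)
  have "1 / \<bar>x\<bar> < real M + 1" unfolding M_def by linarith
  then have M2: "1 / (\<bar>x\<bar> * (real M + 1)) \<le> 1" using False by (simp add: field_simps)
  have head: "\<bar>\<Sum>j = 1..m. sin (real j * x) / real j\<bar> \<le> real m * \<bar>x\<bar>" for m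
  proof -
    have "\<bar>\<Sum>j = 1..m. sin (real j * x) / real j\<bar> \<le> (\<Sum>j = 1..m. \<bar>x\<bar>)"
      using abs_sin_mult_le
      by (intro order.trans[OF sum_abs] sum_mono) (auto simp: field_simps)
    then show ?thesis by simp
  qed
  show ?thesis
  proof (cases "n \<le> M")
    case True
    then have "real n * \<bar>x\<bar> \<le> real M * \<bar>x\<bar>" by (intro mult_right_mono) auto
    then show ?thesis using head[of n] M1 pi_gt_zero by linarith
  next
    case n: False
    have "(\<Sum>j = M + 1..n. sin (real j * x) / real j)
        = (\<Sum>i<n - M. sin (real (M + 1 + i) * x) / real (M + 1 + i))"
      by (rule sum.reindex_bij_witness[of _ "\<lambda>i. M + 1 + i" "\<lambda>j. j - (M + 1)"]) (use n in auto)
    then have "\<bar>\<Sum>j = M + 1..n. sin (real j * x) / real j\<bar> \<le> pi / \<bar>x\<bar> / (real M + 1)"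
      using sine_tail_bound[OF False assms] by simp
    also have "\<dots> \<le> pi" using mult_left_mono[OF M2, of pi] by simp
    finally have "\<bar>\<Sum>j = M + 1..n. sin (real j * x) / real j\<bar> \<le> pi" .
    moreover have "(\<Sum>j = 1..n. sin (real j * x) / real j)
        = (\<Sum>j = 1..M. sin (real j * x) / real j) + (\<Sum>j = M + 1..n. sin (real j * x) / real j)"
      using n sum.ub_add_nat[of 1 M "\<lambda>j. sin (real j * x) / real j" "n - M"] by simp
    ultimately show ?thesis using head[of M] M1 by linarith
  qed
qed simp

text \<open>Multiplying the sine sum by \<open>e\<^sup>-\<^sup>i\<^sup>s\<^sup>n\<^sup>x\<close> moves its two halves to the frequencies \<open>-s(n + j)\<close> and
\<open>-s(n - j)\<close>. Against \<open>f - S\<^sub>n(f)\<close> the second half integrates to zero, because \<open>\<bar>n - j\<bar> \<le> n\<close>, and the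
first one picks out the coefficients at \<open>s(n + j)\<close>. The sign \<open>s\<close> chooses the side of the spectrum.\<close>

lemma weighted_coeff_sum_le:
  assumes f: "continuous_on UNIV f" and s: "s = 1 \<or> s = -1"
  shows "norm (\<Sum>j = 1..n. fourier_coeff f (s * int (n + j)) / of_nat j)
       \<le> (1 + pi) / pi * norm_L (\<lambda>x. f x - fourier_sum n f x)"
proof -
  define g where "g = (\<lambda>x. f x - fourier_sum n f x)"
  have g: "continuous_on UNIV g"
    unfolding g_def by (intro continuous_intros f continuous_fourier_sum)
  have gc: "fourier_coeff g k = (if \<bar>k\<bar> \<le> int n then 0 else fourier_coeff f k)" for k
    unfolding g_def by (simp add: fourier_coeff_diff f continuous_fourier_sum fourier_coeff_fourier_sum)
  define \<Phi> where "\<Phi> = (\<lambda>x. trig (- (s * int n)) x * of_real (\<Sum>j = 1..n. sin (real j * x) / real j))"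
  define c :: "nat \<Rightarrow> complex" where "c = (\<lambda>j. - \<i> / (2 * of_nat j))"
  have I: "integral {-pi..pi} (\<lambda>x. g x * trig k x) = 2 * pi * fourier_coeff g (- k)" for k
    by (simp add: fourier_coeff_continuous[OF g])
  have g\<Phi>: "g x * \<Phi> x = (\<Sum>j = 1..n. c j * (g x * trig (int j - s * int n) x - g x * trig (- int j - s * int n) x))" for x
  proof -
    have "of_real (sin (real j * x) / real j) = c j * (trig (int j) x - trig (- int j) x)" for j
    proof -
      have "complex_of_real (sin (real j * x)) = (trig (int j) x - trig (- int j) x) / (2 * \<i>)"
        using sin_eq_trig[of "int j" x] by (simp only: of_int_of_nat_eq)
      then have "complex_of_real (sin (real j * x) / real j) = (trig (int j) x - trig (- int j) x) / (2 * \<i>) / of_nat j"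
        by (simp only: of_real_divide of_real_of_nat_eq)
      also have "\<dots> = c j * (trig (int j) x - trig (- int j) x)"
        by (simp add: c_def)
      finally show ?thesis .
    qed
    then have "\<Phi> x = (\<Sum>j = 1..n. trig (- (s * int n)) x * (c j * (trig (int j) x - trig (- int j) x)))"
      unfolding \<Phi>_def of_real_sum sum_distrib_left by simp
    moreover have "trig (int j - s * int n) x = trig (int j) x * trig (- (s * int n)) x"
      "trig (- int j - s * int n) x = trig (- int j) x * trig (- (s * int n)) x" for j
      by (simp_all flip: trig_add)
    ultimately show ?thesis by (simp add: sum_distrib_left algebra_simps diff_divide_distrib)
  qed
  have "integral {-pi..pi} (\<lambda>x. g x * \<Phi> x)
      = (\<Sum>j = 1..n. c j * (integral {-pi..pi} (\<lambda>x. g x * trig (int j - s * int n) x)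
          - integral {-pi..pi} (\<lambda>x. g x * trig (- int j - s * int n) x)))"
  proof -
    have int: "(\<lambda>x. g x * trig k x) integrable_on {-pi..pi}" for k
      by (intro continuous_integrable continuous_intros g)
    show ?thesis
      unfolding g\<Phi>
      by (simp add: integral_sum integral_diff integrable_diff integrable_on_mult_right int)
  qed
  also have "\<dots> = (\<Sum>j = 1..n. of_int s * (\<i> * pi) * (fourier_coeff f (s * int (n + j)) / of_nat j))"
  proof (intro sum.cong refl)
    fix j assume j: "j \<in> {1..n}"
    show "c j * (integral {-pi..pi} (\<lambda>x. g x * trig (int j - s * int n) x)
          - integral {-pi..pi} (\<lambda>x. g x * trig (- int j - s * int n) x))
        = of_int s * (\<i> * pi) * (fourier_coeff f (s * int (n + j)) / of_nat j)"
      using s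
    proof
      assume s: "s = 1"
      have "fourier_coeff g (- (int j - s * int n)) = 0"
        "fourier_coeff g (- (- int j - s * int n)) = fourier_coeff f (s * int (n + j))"
        using j s by (simp_all add: gc add.commute)
      then show ?thesis unfolding I by (simp add: s c_def)
    next
      assume s: "s = -1"
      have eq: "- (int j - s * int n) = s * int (n + j)" using s by simp
      have "fourier_coeff g (- (- int j - s * int n)) = 0"
        "fourier_coeff g (- (int j - s * int n)) = fourier_coeff f (s * int (n + j))"
        unfolding eq gc using j s by auto
      then show ?thesis unfolding I by (simp add: s c_def)
    qed
  qed
  also have "\<dots> = of_int s * (\<i> * pi) * (\<Sum>j = 1..n. fourier_coeff f (s * int (n + j)) / of_nat j)"
    by (simp add: sum_distrib_left)
  finally have "norm (integral {-pi..pi} (\<lambda>x. g x * \<Phi> x))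
      = pi * norm (\<Sum>j = 1..n. fourier_coeff f (s * int (n + j)) / of_nat j)"
    using s by (auto simp: norm_mult norm_divide)
  moreover have "norm (integral {-pi..pi} (\<lambda>x. g x * \<Phi> x)) \<le> integral {-pi..pi} (\<lambda>x. norm (g x) * (1 + pi))"
  proof (intro integral_norm_bound_integral continuous_integrable)
    show "continuous_on UNIV (\<lambda>x. g x * \<Phi> x)"
      unfolding \<Phi>_def by (intro continuous_intros g) auto
    show "continuous_on UNIV (\<lambda>x. norm (g x) * (1 + pi))" by (intro continuous_intros g)
    fix x assume "x \<in> {-pi..pi}"
    then have "\<bar>x\<bar> \<le> pi" by auto
    then have "norm (\<Phi> x) \<le> 1 + pi"
      unfolding \<Phi>_def norm_mult norm_trig norm_of_real using sine_sum_bounded[of x n] by simp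
    then show "norm (g x * \<Phi> x) \<le> norm (g x) * (1 + pi)"
      unfolding norm_mult by (intro mult_left_mono) auto
  qed
  moreover have "integral {-pi..pi} (\<lambda>x. norm (g x) * (1 + pi)) = (1 + pi) * norm_L g"
    by (simp add: norm_L_continuous[OF g] mult.commute)
  ultimately show ?thesis by (simp add: g_def field_simps)
qed

section \<open>Recovering a continuous function from its partial sums\<close>

inductive trig_poly :: "(real \<Rightarrow> complex) \<Rightarrow> bool" where
  monomial: "trig_poly (\<lambda>x. c * trig k x)"
| add: "\<lbrakk>trig_poly P; trig_poly Q\<rbrakk> \<Longrightarrow> trig_poly (\<lambda>x. P x + Q x)"

lemma trig_poly_const: "trig_poly (\<lambda>x. c)"
  using trig_poly.monomial[of c 0] by simp

lemma trig_poly_mult: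
  assumes "trig_poly P" "trig_poly Q"
  shows "trig_poly (\<lambda>x. P x * Q x)"
  using assms
proof (induction arbitrary: Q)
  case (monomial c k)
  from monomial show ?case
  proof (induction)
    case (monomial d l)
    have "(\<lambda>x. c * trig k x * (d * trig l x)) = (\<lambda>x. (c * d) * trig (k + l) x)"
      by (simp add: trig_add mult_ac)
    then show ?case by (simp only: trig_poly.monomial)
  next
    case (add P Q)
    then show ?case by (simp only: distrib_left trig_poly.add)
  qed
next
  case (add P1 P2)
  then show ?case by (simp only: distrib_right trig_poly.add)
qed

lemma continuous_trig_poly: "trig_poly P \<Longrightarrow> continuous_on S P"
  by (induction rule: trig_poly.induct) (auto intro!: continuous_intros)

text \<open>On the unit circle the real-linear forms are combinations of \<open>cos x\<close> and \<open>sin x\<close>.\<close>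

lemma trig_poly_real_polynomial:
  fixes p :: "complex \<Rightarrow> real"
  assumes "real_polynomial_function p"
  shows "trig_poly (\<lambda>x. of_real (p (cis x)))"
  using assms
proof induction
  case (linear h)
  have "h (cis x) = cos x * h 1 + sin x * h \<i>" for x
  proof -
    have "cis x = cos x *\<^sub>R 1 + sin x *\<^sub>R \<i>" by (simp add: complex_eq_iff)
    then have "h (cis x) = h (cos x *\<^sub>R 1 + sin x *\<^sub>R \<i>)" by simp
    then show ?thesis
      using linear by (simp add: bounded_linear.linear linear_add linear_scale)
  qed
  moreover have "complex_of_real (cos x) = (trig 1 x + trig (-1) x) / 2" for x
    using cos_exp_eq[of "of_real x"] by (simp add: trig_def cos_of_real)
  moreover have "complex_of_real (sin x) = (trig 1 x - trig (-1) x) / (2 * \<i>)" for x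
    using sin_eq_trig[of 1 x] by (simp only: of_int_1 mult_1)
  ultimately have "complex_of_real (h (cis x))
      = (trig 1 x + trig (-1) x) / 2 * h 1 + (trig 1 x - trig (-1) x) / (2 * \<i>) * h \<i>" for x
    by (simp only: of_real_add of_real_mult)
  moreover have "(trig 1 x + trig (-1) x) / 2 * h 1 + (trig 1 x - trig (-1) x) / (2 * \<i>) * h \<i>
      = (h 1 / 2 + h \<i> / (2 * \<i>)) * trig 1 x + (h 1 / 2 - h \<i> / (2 * \<i>)) * trig (-1) x" for x
    by (simp add: algebra_simps add_divide_distrib diff_divide_distrib)
  ultimately have "(\<lambda>x. complex_of_real (h (cis x)))
      = (\<lambda>x. (h 1 / 2 + h \<i> / (2 * \<i>)) * trig 1 x + (h 1 / 2 - h \<i> / (2 * \<i>)) * trig (-1) x)"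
    by (simp only:)
  then show ?case by (simp only: trig_poly.intros)
next
  case (const c)
  show ?case by (rule trig_poly_const)
next
  case (add f g)
  then show ?case by (simp add: trig_poly.add)
next
  case (mult f g)
  then show ?case by (simp add: trig_poly_mult)
qed

lemma trig_poly_polynomial:
  fixes p :: "complex \<Rightarrow> complex"
  assumes "polynomial_function p"
  shows "trig_poly (\<lambda>x. p (cis x))"
proof -
  have "real_polynomial_function (Re \<circ> p)" "real_polynomial_function (Im \<circ> p)"
    using assms bounded_linear_Re bounded_linear_Im unfolding polynomial_function_def by blast+
  then have "trig_poly (\<lambda>x. of_real ((Re \<circ> p) (cis x)) + \<i> * of_real ((Im \<circ> p) (cis x)))"
    by (intro trig_poly.add trig_poly_mult trig_poly_const trig_poly_real_polynomial)
  moreover have "(\<lambda>x. of_real ((Re \<circ> p) (cis x)) + \<i> * of_real ((Im \<circ> p) (cis x))) = (\<lambda>x. p (cis x))"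
    by (simp add: fun_eq_iff complex_eq_iff)
  ultimately show ?thesis by simp
qed

text \<open>The two branches of the argument have their cuts on opposite half-lines. A periodic function
composed with either is the same function of \<open>z \<noteq> 0\<close>; if it is continuous, so is the composition at every such point.\<close>

lemma periodic_Arg_Arg2pi:
  assumes per: "\<And>x. f (x + 2 * pi) = f x" and z: "z \<noteq> 0"
  shows "f (Arg z) = f (Arg2pi z)"
proof (cases "Arg2pi z \<le> pi")
  case True
  have "- pi < Arg2pi z" using Arg2pi_ge_0[of z] pi_gt_zero by linarith
  then have "Arg z = Arg2pi z"
    using Arg2pi_eq[of z] True z by (intro Arg_unique[of "norm z"]) auto
  then show ?thesis by simp
next
  case False
  have "exp (\<i> * of_real (Arg2pi z - 2 * pi)) = exp (\<i> * of_real (Arg2pi z))"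
    by (simp add: algebra_simps exp_diff)
  then have "Arg z = Arg2pi z - 2 * pi"
    using Arg2pi_eq[of z] Arg2pi_lt_2pi[of z] False z pi_gt_zero
    by (intro Arg_unique[of "norm z"]) auto
  then show ?thesis using per[of "Arg z"] by simp
qed

text \<open>Transplanted to the unit circle, the function becomes continuous on a compact set, and
Stone-Weierstrass supplies a polynomial in the real and imaginary parts of \<open>e\<^sup>i\<^sup>x\<close>.\<close>

lemma trig_poly_approximation:
  fixes \<phi> :: "real \<Rightarrow> complex"
  assumes cont: "continuous_on UNIV \<phi>" and per: "\<And>x. \<phi> (x + 2 * pi) = \<phi> x" and e: "e > 0"
  obtains P where "trig_poly P" "\<And>x. x \<in> {-pi..pi} \<Longrightarrow> norm (\<phi> x - P x) < e"
proof -
  define F where "F = (\<lambda>z. \<phi> (Arg z))"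
  have isC: "isCont \<phi> x" for x using cont by (simp add: continuous_on_eq_continuous_at)
  have "isCont F z" if z: "z \<in> sphere 0 1" for z
  proof (cases "z \<in> \<real>\<^sub>\<le>\<^sub>0")
    case False
    then show ?thesis unfolding F_def
      using isCont_o2[OF continuous_at_Arg isC] by blast
  next
    case True
    have nz: "z \<noteq> 0" using z by auto
    then have "z \<notin> \<real>\<^sub>\<ge>\<^sub>0" using True by (auto simp: complex_nonpos_Reals_iff complex_nonneg_Reals_iff complex_eq_iff)
    then have "isCont (\<lambda>z. \<phi> (Arg2pi z)) z"
      using isCont_o2[OF continuous_at_Arg2pi isC] by blast
    moreover have "\<forall>\<^sub>F w in nhds z. w \<noteq> 0" using nz by (rule t1_space_nhds)
    then have "\<forall>\<^sub>F w in nhds z. F w = \<phi> (Arg2pi w)"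
      by eventually_elim (simp add: F_def periodic_Arg_Arg2pi[of \<phi>, OF per])
    ultimately show ?thesis
      using isCont_cong[where f = F and g = "\<lambda>w. \<phi> (Arg2pi w)" and x = z] by simp
  qed
  then have "continuous_on (sphere 0 1) F" by (simp add: continuous_at_imp_continuous_on)
  from Stone_Weierstrass_polynomial_function[OF compact_sphere this e]
  obtain p where p: "polynomial_function p" "\<forall>z \<in> sphere 0 1. norm (F z - p z) < e" by blast
  show ?thesis
  proof (rule that[OF trig_poly_polynomial[OF p(1)]])
    fix x assume x: "x \<in> {-pi..pi}"
    have "F (cis x) = \<phi> x"
    proof (cases "x = -pi")
      case True
      have "cis (- pi) = - 1" by (simp add: complex_eq_iff)
      then have "F (cis x) = \<phi> pi" using Arg_cis[of pi] True by (simp add: F_def)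
      then show ?thesis using per[of "-pi"] True by simp
    next
      case False
      then show ?thesis using x by (simp add: F_def Arg_cis)
    qed
    moreover have "cis x \<in> sphere 0 1" by simp
    ultimately show "norm (\<phi> x - p (cis x)) < e" using p(2) by metis
  qed
qed

lemma integral_remainder_trig_poly:
  assumes f: "continuous_on UNIV f" and "trig_poly P"
  shows "\<exists>N. \<forall>m\<ge>N. integral {-pi..pi} (\<lambda>x. (f x - fourier_sum m f x) * P x) = 0"
  using assms(2)
proof induction
  case (monomial c k)
  show ?case
  proof (intro exI[of _ "nat \<bar>k\<bar>"] allI impI)
    fix m assume m: "nat \<bar>k\<bar> \<le> m"
    have g: "continuous_on UNIV (\<lambda>x. f x - fourier_sum m f x)"
      by (intro continuous_intros f continuous_fourier_sum)
    have "integral {-pi..pi} (\<lambda>x. (f x - fourier_sum m f x) * (\<Sum>j\<in>{k}. c * trig j x))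
        = 2 * pi * (\<Sum>j\<in>{k}. c * fourier_coeff (\<lambda>x. f x - fourier_sum m f x) (- j))"
      by (rule integral_mult_trig_sum[OF g]) simp
    also have "\<dots> = 0"
      using m by (simp add: fourier_coeff_diff f continuous_fourier_sum fourier_coeff_fourier_sum)
    finally show "integral {-pi..pi} (\<lambda>x. (f x - fourier_sum m f x) * (c * trig k x)) = 0" by simp
  qed
next
  case (add P Q)
  then obtain N1 N2 where N: "\<forall>m\<ge>N1. integral {-pi..pi} (\<lambda>x. (f x - fourier_sum m f x) * P x) = 0"
    "\<forall>m\<ge>N2. integral {-pi..pi} (\<lambda>x. (f x - fourier_sum m f x) * Q x) = 0" by blast
  show ?case
  proof (intro exI[of _ "max N1 N2"] allI impI)
    fix m assume "max N1 N2 \<le> m"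
    moreover have "integral {-pi..pi} (\<lambda>x. (f x - fourier_sum m f x) * (P x + Q x))
      = integral {-pi..pi} (\<lambda>x. (f x - fourier_sum m f x) * P x)
        + integral {-pi..pi} (\<lambda>x. (f x - fourier_sum m f x) * Q x)"
      unfolding distrib_left
      by (intro integral_add continuous_integrable continuous_intros f continuous_fourier_sum
          continuous_trig_poly add)
    ultimately show "integral {-pi..pi} (\<lambda>x. (f x - fourier_sum m f x) * (P x + Q x)) = 0"
      using N by simp
  qed
qed

text \<open>Duality. The function \<open>\<phi> = cnj g / (\<bar>g\<bar> + e)\<close> is a continuous substitute for the conjugate sign of
\<open>g = f - S\<^sub>n(f)\<close>: it is bounded by \<open>1\<close> and \<open>g \<phi> \<ge> \<bar>g\<bar> - e\<close>. Replacing \<open>\<phi>\<close> by a nearby trigonometric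
polynomial \<open>P\<close>, the integral of \<open>g P\<close> does not change when \<open>f\<close> is replaced by \<open>S\<^sub>m(f)\<close> with \<open>m\<close> large, and
the latter integral is at most \<open>(1 + e) B\<close>.\<close>

lemma norm_L_le_frequently_partial_sums:
  assumes f: "continuous_on UNIV f" and per: "\<And>x. f (x + 2 * pi) = f x"
    and B: "\<And>M. \<exists>m\<ge>M. norm_L (\<lambda>x. fourier_sum m f x - fourier_sum n f x) \<le> B"
  shows "norm_L (\<lambda>x. f x - fourier_sum n f x) \<le> B"
proof -
  define g where "g = (\<lambda>x. f x - fourier_sum n f x)"
  have g: "continuous_on UNIV g"
    unfolding g_def by (intro continuous_intros f continuous_fourier_sum)
  have gper: "g (x + 2 * pi) = g x" for x
    by (simp add: g_def per fourier_sum_eq trig_periodic)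
  have B0: "0 \<le> B" using B norm_L_nonneg order.trans by blast
  have key: "norm_L g \<le> (1 + e) * B + e * norm_L g + 2 * pi * e" if e: "e > 0" for e
  proof -
    \<comment> \<open>adding \<open>e\<close> keeps the quotient continuous at the zeros of \<open>g\<close>\<close>
    define \<phi> where "\<phi> = (\<lambda>x. cnj (g x) / of_real (norm (g x) + e))"
    have pos: "norm (g x) + e > 0" for x using e by (simp add: add_nonneg_pos)
    have nz: "complex_of_real (norm (g x) + e) \<noteq> 0" for x
      using pos[of x] by (metis of_real_eq_0_iff less_irrefl)
    have \<phi>: "continuous_on UNIV \<phi>"
      unfolding \<phi>_def using nz by (intro continuous_intros g) auto
    have \<phi>per: "\<phi> (x + 2 * pi) = \<phi> x" for x by (simp add: \<phi>_def gper)
    have \<phi>1: "norm (\<phi> x) \<le> 1" for x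
    proof -
      have "norm (\<phi> x) = norm (g x) / (norm (g x) + e)"
        unfolding \<phi>_def norm_divide norm_of_real using pos[of x] by simp
      then show ?thesis using pos[of x] e by simp
    qed
    have g\<phi>: "norm (g x) \<le> Re (g x * \<phi> x) + e" for x
    proof -
      have "g x * \<phi> x = of_real ((norm (g x))\<^sup>2 / (norm (g x) + e))"
        unfolding \<phi>_def times_divide_eq_right complex_norm_square[symmetric] by simp
      then have "Re (g x * \<phi> x) = (norm (g x))\<^sup>2 / (norm (g x) + e)" by simp
      moreover have "(norm (g x) - e) * (norm (g x) + e) \<le> (norm (g x))\<^sup>2"
        by (simp add: algebra_simps power2_eq_square)
      then have "norm (g x) - e \<le> (norm (g x))\<^sup>2 / (norm (g x) + e)"
        using pos[of x] by (simp add: pos_le_divide_eq)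
      ultimately show ?thesis by linarith
    qed
    obtain P where P: "trig_poly P" and P\<phi>: "\<And>x. x \<in> {-pi..pi} \<Longrightarrow> norm (\<phi> x - P x) < e"
      using trig_poly_approximation[OF \<phi> \<phi>per e] by blast
    have Pc: "continuous_on UNIV P" by (rule continuous_trig_poly[OF P])
    obtain N where N: "\<forall>m\<ge>N. integral {-pi..pi} (\<lambda>x. (f x - fourier_sum m f x) * P x) = 0"
      using integral_remainder_trig_poly[OF f P] by blast
    obtain m where m: "m \<ge> N" "norm_L (\<lambda>x. fourier_sum m f x - fourier_sum n f x) \<le> B"
      using B by blast
    define h where "h = (\<lambda>x. fourier_sum m f x - fourier_sum n f x)"
    have h: "continuous_on UNIV h" unfolding h_def by (intro continuous_intros continuous_fourier_sum)
    have gP: "continuous_on UNIV (\<lambda>x. g x * P x)" by (intro continuous_intros g Pc)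
    have "integral {-pi..pi} (\<lambda>x. g x * P x)
        = integral {-pi..pi} (\<lambda>x. (f x - fourier_sum m f x) * P x + h x * P x)"
      by (simp add: g_def h_def algebra_simps)
    also have "\<dots> = integral {-pi..pi} (\<lambda>x. (f x - fourier_sum m f x) * P x)
          + integral {-pi..pi} (\<lambda>x. h x * P x)"
      by (intro integral_add continuous_integrable continuous_intros f continuous_fourier_sum Pc h)
    finally have "norm (integral {-pi..pi} (\<lambda>x. g x * P x)) = norm (integral {-pi..pi} (\<lambda>x. h x * P x))"
      using N m(1) by simp
    also have "\<dots> \<le> integral {-pi..pi} (\<lambda>x. (1 + e) * norm (h x))"
    proof (intro integral_norm_bound_integral continuous_integrable continuous_intros h Pc)
      fix x assume x: "x \<in> {-pi..pi}"
      have "norm (P x) \<le> 1 + e"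
        using P\<phi>[OF x] \<phi>1[of x] norm_triangle_sub[of "P x" "\<phi> x"] by (simp add: norm_minus_commute)
      then show "norm (h x * P x) \<le> (1 + e) * norm (h x)"
        unfolding norm_mult by (subst mult.commute) (intro mult_right_mono, auto)
    qed
    also have "\<dots> = (1 + e) * norm_L h" by (simp add: norm_L_continuous[OF h])
    also have "\<dots> \<le> (1 + e) * B" using m(2) e unfolding h_def by (intro mult_left_mono) auto
    finally have up: "norm (integral {-pi..pi} (\<lambda>x. g x * P x)) \<le> (1 + e) * B" .
    have "norm_L g \<le> integral {-pi..pi} (\<lambda>x. Re (g x * P x) + (e * norm (g x) + e))"
    proof (intro norm_L_mono g continuous_integrable continuous_intros Pc)
      fix x assume x: "x \<in> {-pi..pi}"
      have "Re (g x * \<phi> x) - Re (g x * P x) = Re (g x * (\<phi> x - P x))" by (simp add: algebra_simps)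
      also have "\<dots> \<le> norm (g x) * norm (\<phi> x - P x)"
        by (metis complex_Re_le_cmod norm_mult)
      also have "\<dots> \<le> norm (g x) * e" using P\<phi>[OF x] by (intro mult_left_mono) auto
      finally show "norm (g x) \<le> Re (g x * P x) + (e * norm (g x) + e)"
        using g\<phi>[of x] by (simp add: mult.commute)
    qed
    also have "\<dots> = integral {-pi..pi} (\<lambda>x. Re (g x * P x))
        + integral {-pi..pi} (\<lambda>x. e * norm (g x) + e)"
      by (intro integral_add continuous_integrable continuous_intros g Pc)
    also have "integral {-pi..pi} (\<lambda>x. e * norm (g x) + e) = e * norm_L g + 2 * pi * e"
      by (subst integral_add) (auto intro!: continuous_integrable continuous_intros g simp: norm_L_continuous[OF g])
    also have "integral {-pi..pi} (\<lambda>x. Re (g x * P x)) = Re (integral {-pi..pi} (\<lambda>x. g x * P x))"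
      using integral_linear[OF continuous_integrable[OF gP] bounded_linear_Re] by (simp add: o_def)
    also have "\<dots> \<le> (1 + e) * B" using complex_Re_le_cmod up by (rule order.trans)
    finally show ?thesis by simp
  qed
  have "((\<lambda>e. (1 + e) * B + e * norm_L g + 2 * pi * e) \<longlongrightarrow> (1 + 0) * B + 0 * norm_L g + 2 * pi * 0) (at_right 0)"
    by (intro tendsto_intros)
  moreover have "\<forall>\<^sub>F e in at_right 0. norm_L g \<le> (1 + e) * B + e * norm_L g + 2 * pi * e"
    using key by (auto simp: eventually_at_right_less eventually_at_filter)
  ultimately have "norm_L g \<le> (1 + 0) * B + 0 * norm_L g + 2 * pi * 0"
    by (intro tendsto_lowerbound) auto
  then show ?thesis by (simp add: g_def)
qed

section \<open>Dyadic blocks of the Fourier series\<close>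

text \<open>After extraction of the unimodular factor \<open>e\<^sup>i\<^sup>s\<^sup>(\<^sup>n\<^sup>+\<^sup>1\<^sup>)\<^sup>x\<close>, summation by parts leaves kernels of length at most
\<open>n\<close>. The sum starts at \<open>n + 1\<close>, and the boundary coefficient is the one just after the block.\<close>

lemma norm_L_one_sided_block:
  fixes c :: "nat \<Rightarrow> complex"
  assumes s: "s = 1 \<or> s = -1"
  shows "norm_L (\<lambda>x. \<Sum>k = n + 1..2 * n. c k * trig (s * int k) x)
     \<le> 4 * pi * (ln (real n + 1) * (norm (c (2 * n + 1)) + (\<Sum>k = n..2 * n. norm (c (k + 1) - c k))))"
proof -
  define D where "D = (\<lambda>k x. norm (\<Sum>i<k. trig (int i) x))"
  define d where "d = (\<lambda>i. c (n + 1 + i))"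
  have Dc: "continuous_on UNIV (D k)" for k unfolding D_def by (intro continuous_intros)
  have Ds: "norm (\<Sum>i<k. trig (s * int i) x) = D k x" for k x
  proof -
    have "cnj (trig j x) = trig (- j) x" for j by (simp add: trig_def exp_cnj)
    then have "norm (\<Sum>i<k. trig (- int i) x) = norm (cnj (\<Sum>i<k. trig (int i) x))" by simp
    then show ?thesis using s by (auto simp: D_def simp del: cnj_sum)
  qed
  have Dint: "integral {-pi..pi} (D k) \<le> 4 * pi * ln (real n + 1)" if "k \<le> n" for k
  proof -
    have "integral {-pi..pi} (D k) = norm_L (\<lambda>x. \<Sum>i<k. trig (int i) x)"
      unfolding D_def by (intro norm_L_continuous[symmetric] continuous_intros)
    also have "\<dots> \<le> 4 * pi * ln (real k + 1)" by (rule norm_L_sum_trig)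
    also have "\<dots> \<le> 4 * pi * ln (real n + 1)" using that by simp
    finally show ?thesis .
  qed
  have eq: "(\<Sum>k = n + 1..2 * n. c k * trig (s * int k) x)
      = trig (s * int (n + 1)) x * (\<Sum>i<n. d i * trig (s * int i) x)" for x
  proof -
    have shift: "trig (s * int (n + 1 + i)) x = trig (s * int (n + 1)) x * trig (s * int i) x" for i
      by (simp only: trig_add[symmetric] of_nat_add[of "n + 1" i] distrib_left)
    have "(\<Sum>k = n + 1..2 * n. c k * trig (s * int k) x)
        = (\<Sum>i<n. c (n + 1 + i) * trig (s * int (n + 1 + i)) x)"
      by (rule sum.reindex_bij_witness[of _ "\<lambda>i. n + 1 + i" "\<lambda>k. k - (n + 1)"]) auto
    also have "\<dots> = trig (s * int (n + 1)) x * (\<Sum>i<n. d i * trig (s * int i) x)"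
      unfolding shift d_def sum_distrib_left by (simp only: mult_ac)
    finally show ?thesis .
  qed
  have "norm_L (\<lambda>x. \<Sum>k = n + 1..2 * n. c k * trig (s * int k) x)
      \<le> integral {-pi..pi} (\<lambda>x. norm (d n) * D n x + (\<Sum>i<n. norm (d (Suc i) - d i) * D (Suc i) x))"
  proof (intro norm_L_mono continuous_integrable continuous_intros Dc)
    show "norm (\<Sum>k = n + 1..2 * n. c k * trig (s * int k) x)
        \<le> norm (d n) * D n x + (\<Sum>i<n. norm (d (Suc i) - d i) * D (Suc i) x)" for x
      using abel_bound[of d "\<lambda>i. trig (s * int i) x" n]
      by (simp only: eq norm_mult norm_trig mult_1 Ds)
  qed
  also have "\<dots> = norm (d n) * integral {-pi..pi} (D n)
      + (\<Sum>i<n. norm (d (Suc i) - d i) * integral {-pi..pi} (D (Suc i)))"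
    by (simp add: integral_add integral_sum continuous_integrable continuous_intros Dc)
  also have "\<dots> \<le> norm (d n) * (4 * pi * ln (real n + 1))
      + (\<Sum>i<n. norm (d (Suc i) - d i) * (4 * pi * ln (real n + 1)))"
    by (intro add_mono mult_left_mono sum_mono Dint) auto
  also have "\<dots> = 4 * pi * (ln (real n + 1) * (norm (d n) + (\<Sum>i<n. norm (d (Suc i) - d i))))"
    by (simp add: sum_distrib_left algebra_simps)
  also have "\<dots> \<le> 4 * pi * (ln (real n + 1) * (norm (c (2 * n + 1)) + (\<Sum>k = n..2 * n. norm (c (k + 1) - c k))))"
  proof (intro mult_left_mono add_mono)
    show "norm (d n) \<le> norm (c (2 * n + 1))" by (simp add: d_def mult_2)
    have "(\<Sum>i<n. norm (d (Suc i) - d i)) = (\<Sum>k = n + 1..2 * n. norm (c (k + 1) - c k))"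
      by (rule sum.reindex_bij_witness[of _ "\<lambda>k. k - (n + 1)" "\<lambda>i. n + 1 + i"]) (auto simp: d_def)
    also have "\<dots> \<le> (\<Sum>k = n..2 * n. norm (c (k + 1) - c k))" by (intro sum_mono2) auto
    finally show "(\<Sum>i<n. norm (d (Suc i) - d i)) \<le> (\<Sum>k = n..2 * n. norm (c (k + 1) - c k))" .
  qed auto
  finally show ?thesis .
qed

lemma fourier_sum_double:
  "fourier_sum (2 * n) f x - fourier_sum n f x
     = (\<Sum>k = n + 1..2 * n. fourier_coeff f (int k) * trig (1 * int k) x)
       + (\<Sum>k = n + 1..2 * n. fourier_coeff f (- int k) * trig (-1 * int k) x)"
proof -
  let ?t = "\<lambda>k. fourier_coeff f k * trig k x"
  have A: "(\<Sum>k = int n + 1..int (2 * n). ?t k) = (\<Sum>k = n + 1..2 * n. ?t (int k))"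
    by (rule sum.reindex_bij_witness[of _ int nat]) auto
  have B: "(\<Sum>k = - int (2 * n)..- int n - 1. ?t k) = (\<Sum>k = n + 1..2 * n. ?t (- int k))"
    by (rule sum.reindex_bij_witness[of _ "\<lambda>k. - int k" "\<lambda>k. nat (- k)"]) auto
  have "{- int (2 * n)..int (2 * n)}
      = {- int n..int n} \<union> ({int n + 1..int (2 * n)} \<union> {- int (2 * n)..- int n - 1})" by auto
  then have "fourier_sum (2 * n) f x = (\<Sum>k\<in>{- int n..int n} \<union> ({int n + 1..int (2 * n)} \<union> {- int (2 * n)..- int n - 1}). ?t k)"
    unfolding fourier_sum_eq by (rule arg_cong)
  also have "\<dots> = (\<Sum>k = - int n..int n. ?t k)
      + ((\<Sum>k = int n + 1..int (2 * n). ?t k) + (\<Sum>k = - int (2 * n)..- int n - 1. ?t k))"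
    by (subst sum.union_disjoint, force, force, force, subst sum.union_disjoint) auto
  finally have "fourier_sum (2 * n) f x = fourier_sum n f x
      + ((\<Sum>k = n + 1..2 * n. ?t (int k)) + (\<Sum>k = n + 1..2 * n. ?t (- int k)))"
    by (simp only: A B fourier_sum_eq)
  then show ?thesis by simp
qed

section \<open>Sequences of mean value bounded variation\<close>

text \<open>In a sector of half-angle below \<open>\<pi>/2\<close> the real part controls the modulus, so a sum with
nonnegative weights keeps at least the fraction \<open>cos \<theta>\<close> of the sum of the moduli.\<close>

lemma sector_Re_ge:
  assumes "0 \<le> \<theta>" "\<theta> < pi / 2" "z \<in> sector \<theta>"
  shows "cos \<theta> * norm z \<le> Re z"
proof (cases "z = 0")
  case False
  then have "\<bar>Arg z\<bar> \<le> \<theta>" using assms(3) by (simp add: sector_def)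
  then have "cos \<theta> \<le> cos \<bar>Arg z\<bar>"
    using assms by (intro cos_monotone_0_pi_le) auto
  then have "cos \<theta> * norm z \<le> cos (Arg z) * norm z"
    by (intro mult_right_mono) (auto simp: cos_abs_real)
  also have "\<dots> = Re z"
    using arg_cong[OF rcis_cmod_Arg[of z], of Re] by (simp add: mult.commute)
  finally show ?thesis .
qed simp

lemma MVBVS_E:
  assumes "c \<in> MVBVS"
  obtains \<kappa> \<Lambda> C :: real
  where "\<kappa> > 0" "\<And>n. \<kappa> * norm (c n) \<le> Re (c n)" "\<Lambda> \<ge> 2" "C > 0"
    "\<And>m. m \<ge> 1 \<Longrightarrow> (\<Sum>k = m..2 * m. norm (c (k + 1) - c k)) \<le>
       C / real m * (\<Sum>k = nat \<lfloor>real m / \<Lambda>\<rfloor>..nat \<lfloor>\<Lambda> * real m\<rfloor>. norm (c k))"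
proof -
  from assms obtain \<theta> \<Lambda> C where *: "\<theta> \<in> {0..<pi / 2}" "\<forall>n. c n \<in> sector \<theta>" "\<Lambda> \<ge> 2" "C > 0"
    "\<forall>m\<ge>1. (\<Sum>k = m..2 * m. norm (c (k + 1) - c k)) \<le>
       C / real m * (\<Sum>k = nat \<lfloor>real m / \<Lambda>\<rfloor>..nat \<lfloor>\<Lambda> * real m\<rfloor>. norm (c k))"
    unfolding MVBVS_def by blast
  show ?thesis
  proof (rule that[of "cos \<theta>" \<Lambda> C])
    show "0 < cos \<theta>" using *(1) by (intro cos_gt_zero_pi) auto
    show "cos \<theta> * norm (c n) \<le> Re (c n)" for n
      using * by (intro sector_Re_ge) auto
  qed (use * in auto)
qed

lemma window_lower:
  fixes \<Lambda> :: real
  assumes "\<Lambda> \<ge> 2"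
  shows "real n / \<Lambda> < real (nat \<lfloor>real n / \<Lambda>\<rfloor>) + 1"
  using assms by linarith

lemma window_upper:
  fixes \<Lambda> :: real
  assumes "\<Lambda> \<ge> 2"
  shows "real (nat \<lfloor>\<Lambda> * real n\<rfloor>) \<le> \<Lambda> * real n"
  using assms by simp

lemma window_covers_octave:
  fixes \<Lambda> :: real
  assumes "\<Lambda> \<ge> 2"
  shows "{n..2 * n} \<subseteq> {nat \<lfloor>real n / \<Lambda>\<rfloor>..nat \<lfloor>\<Lambda> * real n\<rfloor>}"
proof -
  have "real n / \<Lambda> \<le> real n" using assms by (simp add: divide_le_eq mult_le_cancel_left1)
  then have "nat \<lfloor>real n / \<Lambda>\<rfloor> \<le> n" by linarith
  moreover have "2 * real n \<le> \<Lambda> * real n" using assms by (intro mult_right_mono) auto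
  then have "2 * n \<le> nat \<lfloor>\<Lambda> * real n\<rfloor>" by linarith
  ultimately show ?thesis by auto
qed

lemma half_ln_le:
  assumes "sqrt (real n) \<le> x" "n \<ge> 1"
  shows "ln (real n) \<le> 2 * ln x"
proof -
  have "0 < sqrt (real n)" using assms(2) by simp
  then have "ln (sqrt (real n)) \<le> ln x" using assms(1) by (intro ln_mono) auto
  then show ?thesis using assms(2) by (simp add: ln_sqrt)
qed

lemma tame_rate_doubling:
  fixes \<Lambda> :: real
  assumes "tame_rate \<psi>"
  obtains K where "K \<ge> 0" "\<And>n k. real n < \<Lambda> * (real k + 1) \<Longrightarrow> \<psi> k \<le> K * \<psi> n"
proof -
  define L where "L = nat \<lceil>\<Lambda>\<rceil> + 1"
  from assms obtain K where K: "K \<ge> 0" "\<And>n m. m + 1 \<le> L * (n + 1) \<Longrightarrow> \<psi> n \<le> K * \<psi> m"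
    unfolding tame_rate_def by meson
  show ?thesis
  proof (rule that[OF K(1)])
    fix n k assume "real n < \<Lambda> * (real k + 1)"
    also have "\<Lambda> * (real k + 1) \<le> real (nat \<lceil>\<Lambda>\<rceil>) * (real k + 1)"
      by (intro mult_right_mono) linarith+
    finally have "real n + 1 \<le> real (L * (k + 1))" by (simp add: L_def algebra_simps)
    then have "n + 1 \<le> L * (k + 1)"
      by (metis of_nat_1 of_nat_add of_nat_le_iff)
    then show "\<psi> k \<le> K * \<psi> n" by (rule K(2))
  qed
qed

text \<open>For large \<open>n\<close> an index \<open>k \<ge> \<lfloor>n / \<Lambda>\<rfloor>\<close> is at least \<open>sqrt n\<close>. So \<open>log k \<ge> (log n) / 2\<close>, and \<open>\<psi>(k)\<close> is
bounded by a multiple of \<open>\<psi>(n)\<close>: a bound at \<open>k\<close> turns into one at \<open>n\<close>.\<close>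

lemma log_decay_on_window:
  fixes c :: "nat \<Rightarrow> complex"
  assumes \<psi>: "tame_rate \<psi>" and L: "\<Lambda> \<ge> 2" and A: "A \<ge> 0"
    and c: "\<And>n. n \<ge> N0 \<Longrightarrow> norm (c n) * ln (real n) \<le> A * \<psi> n"
  obtains K N where "K \<ge> 0"
    "\<And>n k. \<lbrakk>n \<ge> N; k \<ge> nat \<lfloor>real n / \<Lambda>\<rfloor>\<rbrakk> \<Longrightarrow> norm (c k) * ln (real n) \<le> K * \<psi> n"
proof -
  obtain K where K: "K \<ge> 0" "\<And>n k. real n < \<Lambda> * (real k + 1) \<Longrightarrow> \<psi> k \<le> K * \<psi> n"
    using tame_rate_doubling[OF \<psi>] by blast
  \<comment> \<open>once \<open>sqrt n \<ge> S\<close>: \<open>n / \<Lambda> - 1 \<ge> 2 sqrt n - 1 \<ge> sqrt n \<ge> N0\<close>\<close>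
  define S where "S = max (2 * \<Lambda>) (real N0)"
  show ?thesis
  proof (rule that[of "2 * A * K" "nat \<lceil>S\<^sup>2\<rceil> + 1"])
    show "0 \<le> 2 * A * K" using A K by simp
    fix n k :: nat assume n: "n \<ge> nat \<lceil>S\<^sup>2\<rceil> + 1" and k: "k \<ge> nat \<lfloor>real n / \<Lambda>\<rfloor>"
    have "S\<^sup>2 \<le> real n" using n by linarith
    then have S: "S \<le> sqrt (real n)" by (rule real_le_rsqrt)
    have n1: "n \<ge> 1" using n by simp
    have "real n / \<Lambda> < real k + 1" using window_lower[OF L, of n] k by linarith
    then have nk: "real n < \<Lambda> * (real k + 1)" using L by (simp add: field_simps)
    have "sqrt (real n) * (2 * \<Lambda>) \<le> sqrt (real n) * sqrt (real n)"
      using S by (intro mult_left_mono) (auto simp: S_def)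
    then have "2 * sqrt (real n) \<le> real n / \<Lambda>" using L by (simp add: field_simps)
    moreover have "1 \<le> sqrt (real n)" using n1 by simp
    ultimately have rt: "sqrt (real n) \<le> real k" using \<open>real n / \<Lambda> < real k + 1\<close> by linarith
    then have "k \<ge> N0" using S by (simp add: S_def)
    have "norm (c k) * ln (real n) \<le> norm (c k) * (2 * ln (real k))"
      using half_ln_le[OF rt n1] by (intro mult_left_mono) auto
    also have "\<dots> \<le> 2 * (A * \<psi> k)" using c[OF \<open>k \<ge> N0\<close>] by simp
    also have "\<dots> \<le> 2 * (A * (K * \<psi> n))" using K(2)[OF nk] A by (intro mult_left_mono) auto
    finally show "norm (c k) * ln (real n) \<le> 2 * A * K * \<psi> n" by (simp add: mult_ac)
  qed
qed

text \<open>The window at \<open>n\<close> has at most \<open>(\<Lambda> + 1) n\<close> indices, and on it the coefficients are \<open>O(\<psi>(n) / log n)\<close>. The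
factor \<open>1 / n\<close> of the mean value condition cancels the length.\<close>

lemma MVBVS_variation_bound:
  assumes \<psi>: "tame_rate \<psi>" and cM: "c \<in> MVBVS" and A: "A \<ge> 0"
    and c: "\<And>n. n \<ge> N0 \<Longrightarrow> norm (c n) * ln (real n) \<le> A * \<psi> n"
  obtains K N where "K \<ge> 0"
    "\<And>n. n \<ge> N \<Longrightarrow> ln (real n + 1) *
        (norm (c (2 * n + 1)) + (\<Sum>k = n..2 * n. norm (c (k + 1) - c k))) \<le> K * \<psi> n"
proof -
  from cM obtain \<kappa> \<Lambda> C :: real where "\<kappa> > 0" and L: "\<Lambda> \<ge> 2" and C: "C > 0"
    and var: "\<And>m. m \<ge> 1 \<Longrightarrow> (\<Sum>k = m..2 * m. norm (c (k + 1) - c k)) \<le>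
       C / real m * (\<Sum>k = nat \<lfloor>real m / \<Lambda>\<rfloor>..nat \<lfloor>\<Lambda> * real m\<rfloor>. norm (c k))"
    by (rule MVBVS_E) blast
  obtain K N where K: "K \<ge> 0" and win:
    "\<And>n k. \<lbrakk>n \<ge> N; k \<ge> nat \<lfloor>real n / \<Lambda>\<rfloor>\<rbrakk> \<Longrightarrow> norm (c k) * ln (real n) \<le> K * \<psi> n"
    using log_decay_on_window[OF \<psi> L A c] by blast
  show ?thesis
  proof (rule that[of "2 * (K + C * ((\<Lambda> + 1) * K))" "max N 2"])
    show "0 \<le> 2 * (K + C * ((\<Lambda> + 1) * K))" using K L C by simp
    fix n assume "n \<ge> max N 2"
    then have n: "n \<ge> N" "n \<ge> 2" by auto
    have \<psi>0: "0 \<le> \<psi> n" using \<psi> by (simp add: tame_rate_def)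
    define p q where "p = nat \<lfloor>real n / \<Lambda>\<rfloor>" and "q = nat \<lfloor>\<Lambda> * real n\<rfloor>"
    define V where "V = (\<Sum>k = n..2 * n. norm (c (k + 1) - c k))"
    define W where "W = (\<Sum>k = p..q. norm (c k))"
    have "p \<le> n" using window_covers_octave[OF L, of n] by (auto simp: p_def)
    have "W * ln (real n) = (\<Sum>k = p..q. norm (c k) * ln (real n))"
      by (simp add: W_def sum_distrib_right)
    also have "\<dots> \<le> (\<Sum>k = p..q. K * \<psi> n)"
      using win[OF n(1)] by (intro sum_mono) (auto simp: p_def)
    also have "\<dots> = real (Suc q - p) * (K * \<psi> n)" by simp
    also have "\<dots> \<le> ((\<Lambda> + 1) * real n) * (K * \<psi> n)"
    proof (intro mult_right_mono)
      have "real (Suc q - p) \<le> real q + 1" by linarith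
      also have "\<dots> \<le> (\<Lambda> + 1) * real n"
        using window_upper[OF L, of n] n(2) by (simp add: q_def algebra_simps)
      finally show "real (Suc q - p) \<le> (\<Lambda> + 1) * real n" .
    qed (use K \<psi>0 in auto)
    finally have W: "W * ln (real n) \<le> real n * ((\<Lambda> + 1) * K * \<psi> n)" by (simp add: mult_ac)
    have "V * ln (real n) \<le> C / real n * W * ln (real n)"
      using var[of n] n(2) by (intro mult_right_mono) (auto simp: V_def W_def p_def q_def)
    also have "\<dots> = C / real n * (W * ln (real n))" by simp
    also have "\<dots> \<le> C / real n * (real n * ((\<Lambda> + 1) * K * \<psi> n))"
      using W C by (intro mult_left_mono) auto
    also have "\<dots> = C * ((\<Lambda> + 1) * K * \<psi> n)" using n(2) by simp
    finally have V: "V * ln (real n) \<le> C * ((\<Lambda> + 1) * K * \<psi> n)" .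
    have last: "norm (c (2 * n + 1)) * ln (real n) \<le> K * \<psi> n"
      using win[OF n(1), of "2 * n + 1"] \<open>p \<le> n\<close> by (simp add: p_def)
    have V0: "0 \<le> V" by (simp add: V_def sum_nonneg)
    have "2 * real n \<le> real n * real n" using n(2) by (intro mult_right_mono) auto
    then have "real n + 1 \<le> real n * real n" using n(2) by linarith
    then have "ln (real n + 1) \<le> ln (real n * real n)" by (intro ln_mono) auto
    also have "\<dots> = 2 * ln (real n)" using n(2) by (simp add: ln_mult)
    finally have "ln (real n + 1) * (norm (c (2 * n + 1)) + V)
        \<le> (2 * ln (real n)) * (norm (c (2 * n + 1)) + V)"
      using V0 by (intro mult_right_mono) auto
    also have "\<dots> \<le> 2 * (K * \<psi> n + C * ((\<Lambda> + 1) * K * \<psi> n))"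
      using V last by (simp add: algebra_simps)
    finally show "ln (real n + 1) * (norm (c (2 * n + 1)) + (\<Sum>k = n..2 * n. norm (c (k + 1) - c k)))
        \<le> 2 * (K + C * ((\<Lambda> + 1) * K)) * \<psi> n"
      by (simp add: V_def algebra_simps)
  qed
qed

text \<open>Summing the hypothesis over all \<open>m\<close> in \<open>[N, M]\<close>: for \<open>j \<le> N\<close> each \<open>k\<close> in \<open>[2N, M]\<close> is \<open>m + j\<close> with
\<open>m = k - j\<close> in the range and \<open>j \<le> m\<close>. So \<open>a k\<close> collects the full harmonic sum up to \<open>N\<close>. This double
counting is where the logarithm is gained.\<close>

lemma sum_times_harm_le:
  fixes a :: "nat \<Rightarrow> real"
  assumes a: "\<And>k. 0 \<le> a k" and D: "0 \<le> D"
    and le: "\<And>m. \<lbrakk>N \<le> m; m \<le> M\<rbrakk> \<Longrightarrow> (\<Sum>j = 1..m. a (m + j) / real j) \<le> D"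
  shows "(\<Sum>k = 2 * N..M. a k) * harm N \<le> (real M + 1) * D"
proof -
  have shift: "(\<Sum>k = 2 * N..M. a k) \<le> (\<Sum>m = N..M. a (m + j))" if "j \<in> {1..N}" for j
  proof -
    have "(\<Sum>m = N..M. a (m + j)) = (\<Sum>k\<in>(\<lambda>m. m + j) ` {N..M}. a k)"
      by (subst sum.reindex) (auto simp: inj_on_def)
    moreover have "{2 * N..M} \<subseteq> (\<lambda>m. m + j) ` {N..M}"
      using that by (auto intro!: image_eqI[of _ _ "_ - j"])
    ultimately show ?thesis using a by (auto intro!: sum_mono2)
  qed
  have "(\<Sum>k = 2 * N..M. a k) * harm N = (\<Sum>j = 1..N. (\<Sum>k = 2 * N..M. a k) / real j)"
    by (simp add: harm_def sum_distrib_left divide_inverse)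
  also have "\<dots> \<le> (\<Sum>j = 1..N. (\<Sum>m = N..M. a (m + j)) / real j)"
    using shift by (intro sum_mono divide_right_mono) auto
  also have "\<dots> = (\<Sum>m = N..M. \<Sum>j = 1..N. a (m + j) / real j)"
    by (subst sum.swap) (simp add: sum_divide_distrib)
  also have "\<dots> \<le> (\<Sum>m = N..M. \<Sum>j = 1..m. a (m + j) / real j)"
    using a by (intro sum_mono sum_mono2) auto
  also have "\<dots> \<le> (\<Sum>m = N..M. D)" using le by (intro sum_mono) auto
  also have "\<dots> = real (Suc M - N) * D" by simp
  also have "\<dots> \<le> (real M + 1) * D" using D by (intro mult_right_mono) linarith+
  finally show ?thesis .
qed

text \<open>The bound \<open>\<bar>c\<^sub>n\<bar> \<le> \<bar>c\<^sub>k\<bar> + \<Sum> \<bar>c\<^sub>i\<^sub>+\<^sub>1 - c\<^sub>i\<bar>\<close>, added up over the \<open>n + 1\<close> indices \<open>k\<close> of \<open>[n, 2n]\<close>.\<close>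

lemma norm_le_average_plus_variation:
  fixes c :: "nat \<Rightarrow> complex"
  shows "(real n + 1) * norm (c n) \<le> (\<Sum>k = n..2 * n. norm (c k))
           + (real n + 1) * (\<Sum>k = n..2 * n. norm (c (k + 1) - c k))"
proof -
  let ?V = "\<Sum>k = n..2 * n. norm (c (k + 1) - c k)"
  have "norm (c n) \<le> norm (c k) + ?V" if "k \<in> {n..2 * n}" for k
  proof -
    have "norm (c k - c n) = norm (\<Sum>i = n..<k. c (i + 1) - c i)"
      using sum_Suc_diff'[of n k c] that by simp
    also have "\<dots> \<le> (\<Sum>i = n..<k. norm (c (i + 1) - c i))" by (rule norm_sum)
    also have "\<dots> \<le> ?V" using that by (intro sum_mono2) auto
    finally show ?thesis using norm_triangle_sub[of "c n" "c k"] by (simp add: norm_minus_commute)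
  qed
  then have "(\<Sum>k = n..2 * n. norm (c n)) \<le> (\<Sum>k = n..2 * n. norm (c k) + ?V)"
    by (intro sum_mono)
  then show ?thesis by (simp add: sum.distrib algebra_simps)
qed

text \<open>With \<open>N = \<lfloor>n / \<Lambda>\<rfloor> div 2\<close> and \<open>M = \<lfloor>\<Lambda> n\<rfloor>\<close>, the interval \<open>[2N, M]\<close> contains the whole window of
the mean value condition at \<open>n\<close>. The averaged bound therefore controls both the mean of \<open>\<bar>c\<^sub>k\<bar>\<close> over
\<open>[n, 2n]\<close> and the variation there, and these two dominate \<open>\<bar>c\<^sub>n\<bar>\<close>.\<close>

lemma MVBVS_log_decay:
  assumes \<psi>: "tame_rate \<psi>" and cM: "c \<in> MVBVS" and A: "A \<ge> 0"
    and c: "\<And>n. n \<ge> N0 \<Longrightarrow> norm (\<Sum>j = 1..n. c (n + j) / of_nat j) \<le> A * \<psi> n"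
  obtains K N where "K \<ge> 0" "\<And>n. n \<ge> N \<Longrightarrow> norm (c n) * ln (real n) \<le> K * \<psi> n"
proof -
  from cM obtain \<kappa> \<Lambda> C :: real where \<kappa>: "\<kappa> > 0" and re: "\<And>n. \<kappa> * norm (c n) \<le> Re (c n)"
    and L: "\<Lambda> \<ge> 2" and C: "C > 0"
    and var: "\<And>m. m \<ge> 1 \<Longrightarrow> (\<Sum>k = m..2 * m. norm (c (k + 1) - c k)) \<le>
       C / real m * (\<Sum>k = nat \<lfloor>real m / \<Lambda>\<rfloor>..nat \<lfloor>\<Lambda> * real m\<rfloor>. norm (c k))"
    by (rule MVBVS_E) blast
  obtain K where K: "K \<ge> 0" "\<And>n k. real n < (2 * \<Lambda>) * (real k + 1) \<Longrightarrow> \<psi> k \<le> K * \<psi> n"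
    using tame_rate_doubling[OF \<psi>] by blast
  have \<psi>0: "0 \<le> \<psi> n" for n using \<psi> by (simp add: tame_rate_def)
  have pos_sum: "(\<Sum>j = 1..m. norm (c (m + j)) / real j) \<le> A / \<kappa> * \<psi> m" if "m \<ge> N0" for m
  proof -
    have "\<kappa> * (\<Sum>j = 1..m. norm (c (m + j)) / real j) = (\<Sum>j = 1..m. \<kappa> * norm (c (m + j)) / real j)"
      by (simp add: sum_distrib_left)
    also have "\<dots> \<le> (\<Sum>j = 1..m. Re (c (m + j)) / real j)"
      by (intro sum_mono divide_right_mono re) auto
    also have "\<dots> = Re (\<Sum>j = 1..m. c (m + j) / of_nat j)" by simp
    also have "\<dots> \<le> A * \<psi> m" using complex_Re_le_cmod c[OF that] by (rule order.trans)
    finally show ?thesis using \<kappa> by (simp add: field_simps)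
  qed
  \<comment> \<open>once \<open>sqrt n \<ge> S\<close>, the index \<open>N\<close> below satisfies \<open>N + 1 > n / (2 \<Lambda>) \<ge> sqrt n \<ge> N0 + 1\<close>\<close>
  define S where "S = max (2 * \<Lambda>) (real N0 + 1)"
  define B where "B = 2 * ((\<Lambda> + 1) * (A / \<kappa> * K))"
  have B: "B \<ge> 0" using L A \<kappa> K by (simp add: B_def)
  show ?thesis
  proof (rule that[of "(1 + C) * B" "nat \<lceil>S\<^sup>2\<rceil> + 1"])
    show "0 \<le> (1 + C) * B" using B C by simp
    fix n assume n: "n \<ge> nat \<lceil>S\<^sup>2\<rceil> + 1"
    have "S\<^sup>2 \<le> real n" using n by linarith
    then have S: "S \<le> sqrt (real n)" by (rule real_le_rsqrt)
    have n1: "n \<ge> 1" using n by simp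
    define p q where "p = nat \<lfloor>real n / \<Lambda>\<rfloor>" and "q = nat \<lfloor>\<Lambda> * real n\<rfloor>"
    define N where "N = p div 2"
    define V where "V = (\<Sum>k = n..2 * n. norm (c (k + 1) - c k))"
    define W where "W = (\<Sum>k = p..q. norm (c k))"
    have W0: "0 \<le> W" by (simp add: W_def sum_nonneg)
    have "p + 1 \<le> 2 * (N + 1)" unfolding N_def by presburger
    then have "real p + 1 \<le> 2 * (real N + 1)"
      using of_nat_mono[of "p + 1" "2 * (N + 1)", where 'a = real] by simp
    then have nN: "real n / \<Lambda> < 2 * (real N + 1)"
      using window_lower[OF L, of n] by (simp add: p_def)
    then have nN': "real n < (2 * \<Lambda>) * (real N + 1)" using L by (simp add: field_simps)
    have "sqrt (real n) * (2 * \<Lambda>) \<le> sqrt (real n) * sqrt (real n)"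
      using S by (intro mult_left_mono) (auto simp: S_def)
    then have "2 * sqrt (real n) \<le> real n / \<Lambda>" using L by (simp add: field_simps)
    then have "2 * sqrt (real n) < 2 * (real N + 1)" using nN by (rule le_less_trans)
    then have rt: "sqrt (real n) \<le> real N + 1" by simp
    then have "N0 \<le> N" using S by (simp add: S_def)
    have "W \<le> (\<Sum>k = 2 * N..q. norm (c k))"
      unfolding W_def by (intro sum_mono2) (auto simp: N_def)
    moreover have harm: "ln (real n) \<le> 2 * harm N"
      using half_ln_le[OF rt n1] ln_le_harm[of N] by linarith
    ultimately have "W * ln (real n) \<le> (\<Sum>k = 2 * N..q. norm (c k)) * (2 * harm N)"
      using n1 by (intro mult_mono) (auto intro: sum_nonneg)
    also have "\<dots> = 2 * ((\<Sum>k = 2 * N..q. norm (c k)) * harm N)" by simp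
    also have "\<dots> \<le> 2 * ((real q + 1) * (A / \<kappa> * \<psi> N))"
    proof (intro mult_left_mono sum_times_harm_le)
      show "0 \<le> A / \<kappa> * \<psi> N" using A \<kappa> \<psi>0 by simp
      fix m assume "N \<le> m" "m \<le> q"
      then have "(\<Sum>j = 1..m. norm (c (m + j)) / real j) \<le> A / \<kappa> * \<psi> m"
        using pos_sum \<open>N0 \<le> N\<close> by simp
      also have "\<dots> \<le> A / \<kappa> * \<psi> N"
        using tame_rate_decreasing[OF \<psi> \<open>N \<le> m\<close>] A \<kappa> by (intro mult_left_mono) auto
      finally show "(\<Sum>j = 1..m. norm (c (m + j)) / real j) \<le> A / \<kappa> * \<psi> N" .
    qed auto
    also have "\<dots> \<le> 2 * (((\<Lambda> + 1) * real n) * (A / \<kappa> * (K * \<psi> n)))"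
    proof (intro mult_left_mono mult_mono)
      show "real q + 1 \<le> (\<Lambda> + 1) * real n"
        using window_upper[OF L, of n] n1 by (simp add: q_def algebra_simps)
      show "\<psi> N \<le> K * \<psi> n" by (rule K(2)[OF nN'])
    qed (use A \<kappa> \<psi>0 L in auto)
    finally have W: "W * ln (real n) \<le> real n * (B * \<psi> n)" by (simp add: B_def mult_ac)
    have "V \<le> C / real n * W"
      using var[OF n1] by (simp add: V_def W_def p_def q_def)
    moreover have "(\<Sum>k = n..2 * n. norm (c k)) \<le> W"
      unfolding W_def p_def q_def by (intro sum_mono2 window_covers_octave L) auto
    moreover note norm_le_average_plus_variation[of n c]
    ultimately have "(real n + 1) * norm (c n) \<le> W + (real n + 1) * (C / real n * W)"
      unfolding V_def[symmetric]
      by (smt (verit, best) mult_left_mono of_nat_0_le_iff)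
    then have "norm (c n) \<le> W / (real n + 1) + C / real n * W"
      by (simp add: field_simps add_pos_nonneg)
    also have "W / (real n + 1) \<le> W / real n"
      using W0 n1 by (intro divide_left_mono) auto
    finally have "norm (c n) \<le> (1 + C) / real n * W" by (simp add: add_divide_distrib algebra_simps)
    then have "norm (c n) * ln (real n) \<le> ((1 + C) / real n * W) * ln (real n)"
      using n1 by (intro mult_right_mono) auto
    also have "\<dots> = (1 + C) / real n * (W * ln (real n))" by simp
    also have "\<dots> \<le> (1 + C) / real n * (real n * (B * \<psi> n))"
      using W C by (intro mult_left_mono) auto
    also have "\<dots> = (1 + C) * B * \<psi> n" using n1 by simp
    finally show "norm (c n) * ln (real n) \<le> (1 + C) * B * \<psi> n" .
  qed
qed

section \<open>The remainder and the coefficients\<close>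

text \<open>A division that consists of the single interval between two points bounds the increment of \<open>f\<close>.\<close>

lemma abs_continuous_imp_continuous:
  assumes "\<And>a b. abs_continuous_on {a..b} f"
  shows "continuous_on UNIV f"
proof -
  have "isCont f x" for x
  proof (rule continuous_at_eps_delta[THEN iffD2], intro allI impI)
    fix e :: real assume e: "e > 0"
    have "abs_continuous_on {x - 1..x + 1} f" by (rule assms)
    then obtain \<delta> where \<delta>: "\<delta> > 0" and
      ac: "\<And>d T. \<lbrakk>d division_of T; T \<subseteq> {x - 1..x + 1}; (\<Sum>K\<in>d. Sup K - Inf K) < \<delta>\<rbrakk>
            \<Longrightarrow> (\<Sum>K\<in>d. norm (f (Sup K) - f (Inf K))) < e"
      using e unfolding abs_continuous_on_def by meson
    have close: "norm (f v - f u) < e"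
      if "u \<le> v" "v - u < \<delta>" "{u..v} \<subseteq> {x - 1..x + 1}" for u v
    proof -
      have "{{u..v}} division_of {u..v}" using that(1) division_of_self[of u v] by simp
      from ac[OF this that(3)] show ?thesis using that by simp
    qed
    show "\<exists>d>0. \<forall>y. dist y x < d \<longrightarrow> dist (f y) (f x) < e"
    proof (intro exI[of _ "min \<delta> 1"] conjI allI impI)
      fix y assume "dist y x < min \<delta> 1"
      then show "dist (f y) (f x) < e"
        using close[of x y] close[of y x]
        by (cases "x \<le> y") (auto simp: dist_norm norm_minus_commute abs_if split: if_splits)
    qed (use \<delta> in auto)
  qed
  then show ?thesis by (simp add: continuous_on_eq_continuous_at)
qed

lemma has_deriv_in_L_imp_continuous:
  assumes "r \<ge> 1" "has_deriv_in_L r f"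
  shows "continuous_on UNIV f"
proof (cases "r = 1")
  case True
  then show ?thesis
    using assms(2) by (intro abs_continuous_imp_continuous) (auto simp: has_deriv_in_L_def nth_deriv_def)
next
  case False
  then have "0 < r - 1" using assms(1) by simp
  then have "\<forall>x. nth_deriv 0 f differentiable (at x)"
    using assms(2) unfolding has_deriv_in_L_def by blast
  then show ?thesis
    by (simp add: nth_deriv_def continuous_on_eq_continuous_at differentiable_imp_continuous_within)
qed

lemma coefficients_from_remainder:
  assumes f: "continuous_on UNIV f" and \<psi>: "tame_rate \<psi>" and s: "s = 1 \<or> s = -1"
    and M: "(\<lambda>n. fourier_coeff f (s * int n)) \<in> MVBVS" and K: "K \<ge> 0"
    and le: "\<And>n. n \<ge> N \<Longrightarrow> norm_L (\<lambda>x. f x - fourier_sum n f x) \<le> K * \<psi> n"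
  obtains K' N' where "K' \<ge> 0" 
    "\<And>n. n \<ge> N' \<Longrightarrow> norm (fourier_coeff f (s * int n)) * ln (real n) \<le> K' * \<psi> n"
proof -
  have "norm (\<Sum>j = 1..n. fourier_coeff f (s * int (n + j)) / of_nat j) \<le> ((1 + pi) / pi * K) * \<psi> n"
    if "n \<ge> N" for n
  proof -
    have "(1 + pi) / pi * norm_L (\<lambda>x. f x - fourier_sum n f x) \<le> (1 + pi) / pi * (K * \<psi> n)"
      using le[OF that] by (intro mult_left_mono) auto
    then show ?thesis using weighted_coeff_sum_le[OF f s, of n] by (simp add: mult.assoc)
  qed
  moreover have "0 \<le> (1 + pi) / pi * K" using K by simp
  ultimately show ?thesis using that MVBVS_log_decay[OF \<psi> M] by blast
qed

lemma tame_rate_dyadic: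
  assumes "tame_rate \<psi>" "n \<ge> 1"
  shows "\<psi> (2 ^ j * n) \<le> 2 * (1 / 2) ^ j * \<psi> n"
proof -
  have \<psi>0: "0 \<le> \<psi> k" for k using assms(1) by (simp add: tame_rate_def)
  have "real n * (2 ^ j * \<psi> (2 ^ j * n)) \<le> (real (2 ^ j * n) + 1) * \<psi> (2 ^ j * n)"
    using \<psi>0[of "2 ^ j * n"] by (simp add: algebra_simps)
  also have "(real (2 ^ j * n) + 1) * \<psi> (2 ^ j * n) \<le> (real n + 1) * \<psi> n"
  proof -
    have "n \<le> 2 ^ j * n" by simp
    then show ?thesis using assms(1) unfolding tame_rate_def by blast
  qed
  also have "\<dots> \<le> (2 * real n) * \<psi> n" using assms(2) \<psi>0 by (intro mult_right_mono) auto
  finally have "real n * (2 ^ j * \<psi> (2 ^ j * n)) \<le> real n * (2 * \<psi> n)" by simp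
  then have "2 ^ j * \<psi> (2 ^ j * n) \<le> 2 * \<psi> n" using assms(2) by simp
  then show ?thesis by (simp add: power_one_over field_simps)
qed

text \<open>The block bounds form a geometric series of ratio \<open>1/2\<close>. The factor \<open>1 - (1/2)\<^sup>J\<close> in the claim for
\<open>S\<^sub>m(f) - S\<^sub>n(f)\<close> with \<open>m = 2\<^sup>J n\<close> makes the induction on \<open>J\<close> close with equality.\<close>

lemma remainder_from_dyadic_blocks:
  assumes f: "continuous_on UNIV f" and per: "\<And>x. f (x + 2 * pi) = f x" and \<psi>: "tame_rate \<psi>"
    and K: "K \<ge> 0" and N: "N \<ge> 1"
    and block: "\<And>n. n \<ge> N \<Longrightarrow> norm_L (\<lambda>x. fourier_sum (2 * n) f x - fourier_sum n f x) \<le> K * \<psi> n"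
    and n: "n \<ge> N"
  shows "norm_L (\<lambda>x. f x - fourier_sum n f x) \<le> 4 * K * \<psi> n"
proof (rule norm_L_le_frequently_partial_sums[OF f per])
  have n1: "n \<ge> 1" using n N by simp
  have \<psi>0: "0 \<le> \<psi> n" using \<psi> by (simp add: tame_rate_def)
  have dyadic: "norm_L (\<lambda>x. fourier_sum (2 ^ J * n) f x - fourier_sum n f x)
      \<le> 4 * K * \<psi> n * (1 - (1 / 2) ^ J)" for J
  proof (induction J)
    case 0
    then show ?case by (simp add: norm_L_def)
  next
    case (Suc J)
    let ?S = "\<lambda>k. fourier_sum k f"
    have "N \<le> 2 ^ J * n" using n by (simp add: order.trans[of N n])
    then have "norm_L (\<lambda>x. ?S (2 * (2 ^ J * n)) x - ?S (2 ^ J * n) x) \<le> K * \<psi> (2 ^ J * n)"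
      by (rule block)
    also have "\<dots> \<le> K * (2 * (1 / 2) ^ J * \<psi> n)"
      by (intro mult_left_mono tame_rate_dyadic \<psi> n1 K)
    finally have step: "norm_L (\<lambda>x. ?S (2 * (2 ^ J * n)) x - ?S (2 ^ J * n) x) \<le> K * (2 * (1 / 2) ^ J * \<psi> n)" .
    have "norm_L (\<lambda>x. ?S (2 ^ Suc J * n) x - ?S n x)
        = norm_L (\<lambda>x. (?S (2 * (2 ^ J * n)) x - ?S (2 ^ J * n) x) + (?S (2 ^ J * n) x - ?S n x))"
      by (simp add: mult.assoc)
    also have "\<dots> \<le> norm_L (\<lambda>x. ?S (2 * (2 ^ J * n)) x - ?S (2 ^ J * n) x)
        + norm_L (\<lambda>x. ?S (2 ^ J * n) x - ?S n x)"
      by (intro norm_L_add_le continuous_absolutely_integrable continuous_intros continuous_fourier_sum)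
    also have "\<dots> \<le> K * (2 * (1 / 2) ^ J * \<psi> n) + 4 * K * \<psi> n * (1 - (1 / 2) ^ J)"
      by (intro add_mono step Suc)
    also have "\<dots> = 4 * K * \<psi> n * (1 - (1 / 2) ^ Suc J)" by (simp add: algebra_simps)
    finally show ?case .
  qed
  show "\<exists>m\<ge>M. norm_L (\<lambda>x. fourier_sum m f x - fourier_sum n f x) \<le> 4 * K * \<psi> n" for M
  proof (intro exI[of _ "2 ^ M * n"] conjI)
    have "M \<le> 2 ^ M * 1" by (simp add: less_imp_le)
    also have "\<dots> \<le> 2 ^ M * n" by (intro mult_left_mono n1) simp
    finally show "M \<le> 2 ^ M * n" .
    have "4 * K * \<psi> n * (1 - (1 / 2) ^ M) \<le> 4 * K * \<psi> n * 1"
      using K \<psi>0 by (intro mult_left_mono) auto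
    then show "norm_L (\<lambda>x. fourier_sum (2 ^ M * n) f x - fourier_sum n f x) \<le> 4 * K * \<psi> n"
      using dyadic[of M] by linarith
  qed
qed

lemma remainder_from_coefficients:
  assumes f: "continuous_on UNIV f" and per: "\<And>x. f (x + 2 * pi) = f x" and \<psi>: "tame_rate \<psi>"
    and Mp: "(\<lambda>n. fourier_coeff f (int n)) \<in> MVBVS" and Mm: "(\<lambda>n. fourier_coeff f (- int n)) \<in> MVBVS"
    and K: "K \<ge> 0"
    and p: "\<And>n. n \<ge> N \<Longrightarrow> norm (fourier_coeff f (int n)) * ln (real n) \<le> K * \<psi> n"
    and m: "\<And>n. n \<ge> N \<Longrightarrow> norm (fourier_coeff f (- int n)) * ln (real n) \<le> K * \<psi> n"
  obtains K' N' where "\<And>n. n \<ge> N' \<Longrightarrow> norm_L (\<lambda>x. f x - fourier_sum n f x) \<le> K' * \<psi> n"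
proof -
  define P where "P = (\<lambda>n. fourier_coeff f (int n))"
  define Q where "Q = (\<lambda>n. fourier_coeff f (- int n))"
  let ?V = "\<lambda>c n. ln (real n + 1) * (norm (c (2 * n + 1)) + (\<Sum>k = n..2 * n. norm (c (k + 1) - c k)))"
  obtain K1 N1 where K1: "K1 \<ge> 0" "\<And>n. n \<ge> N1 \<Longrightarrow> ?V P n \<le> K1 * \<psi> n"
    using MVBVS_variation_bound[OF \<psi> Mp K p] unfolding P_def by blast
  obtain K2 N2 where K2: "K2 \<ge> 0" "\<And>n. n \<ge> N2 \<Longrightarrow> ?V Q n \<le> K2 * \<psi> n"
    using MVBVS_variation_bound[OF \<psi> Mm K m] unfolding Q_def by blast
  have block: "norm_L (\<lambda>x. fourier_sum (2 * n) f x - fourier_sum n f x) \<le> 4 * pi * (K1 + K2) * \<psi> n"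
    if n: "n \<ge> max 1 (max N1 N2)" for n
  proof -
    have "norm_L (\<lambda>x. fourier_sum (2 * n) f x - fourier_sum n f x)
        \<le> norm_L (\<lambda>x. \<Sum>k = n + 1..2 * n. P k * trig (1 * int k) x)
          + norm_L (\<lambda>x. \<Sum>k = n + 1..2 * n. Q k * trig (-1 * int k) x)"
      unfolding fourier_sum_double P_def Q_def by (intro norm_L_add_le continuous_absolutely_integrable continuous_intros)
    also have "\<dots> \<le> 4 * pi * ?V P n + 4 * pi * ?V Q n"
      by (intro add_mono norm_L_one_sided_block) auto
    also have "\<dots> \<le> 4 * pi * (K1 * \<psi> n) + 4 * pi * (K2 * \<psi> n)"
      using n by (intro add_mono mult_left_mono K1 K2) auto
    finally show ?thesis by (simp add: algebra_simps)
  qed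
  have "0 \<le> 4 * pi * (K1 + K2)" using K1 K2 by simp
  from remainder_from_dyadic_blocks[OF f per \<psi> this _ block] show ?thesis
    by (intro that[of "max 1 (max N1 N2)" "4 * (4 * pi * (K1 + K2))"]) auto
qed

theorem corollary3:
  fixes r :: nat and f :: "real \<Rightarrow> complex"
  assumes "r \<ge> 1"
    and "f \<in> L2pi"
    and "has_deriv_in_L r f"
    and "(\<lambda>n::nat. fourier_coeff f (int n)) \<in> MVBVS"
    and "(\<lambda>n::nat. fourier_coeff f (- int n)) \<in> MVBVS"
  shows "(\<lambda>n::nat. norm_L (\<lambda>x. f x - fourier_sum n f x))
           \<in> O[at_top](\<lambda>n. 1 / (real n + 1) ^ r * modulus_L (nth_deriv r f) (1 / (real n + 1)))
     \<longleftrightarrow>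
         (\<lambda>n::int. fourier_coeff f n * complex_of_real (ln (real_of_int \<bar>n\<bar>)))
           \<in> O[filtercomap abs at_top](\<lambda>n. complex_of_real
               (1 / (real_of_int \<bar>n\<bar> + 1) ^ r *
                modulus_L (nth_deriv r f) (1 / (real_of_int \<bar>n\<bar> + 1))))"
proof -
  define \<psi> where "\<psi> = (\<lambda>n. 1 / (real n + 1) ^ r * modulus_L (nth_deriv r f) (1 / (real n + 1)))"
  have "nth_deriv r f \<in> L2pi" using assms(3) by (simp add: has_deriv_in_L_def)
  then have \<psi>: "tame_rate \<psi>" unfolding \<psi>_def using assms(1) by (rule tame_rate_modulus)
  have \<psi>0: "0 \<le> \<psi> n" for n using \<psi> by (simp add: tame_rate_def)
  have f: "continuous_on UNIV f" using has_deriv_in_L_imp_continuous assms by blast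
  have per: "f (x + 2 * pi) = f x" for x using assms(2) by (simp add: L2pi_def)
  have abs_nat: "real_of_int \<bar>n\<bar> = real (nat \<bar>n\<bar>)" for n by simp
  have \<psi>_int: "1 / (real_of_int \<bar>n\<bar> + 1) ^ r * modulus_L (nth_deriv r f) (1 / (real_of_int \<bar>n\<bar> + 1))
      = \<psi> (nat \<bar>n\<bar>)" for n
    unfolding \<psi>_def abs_nat ..
  have "(\<lambda>n::nat. norm_L (\<lambda>x. f x - fourier_sum n f x)) \<in> O[at_top](\<psi>) \<longleftrightarrow>
      (\<lambda>n::int. fourier_coeff f n * complex_of_real (ln (real_of_int \<bar>n\<bar>)))
        \<in> O[filtercomap abs at_top](\<lambda>n. complex_of_real (\<psi> (nat \<bar>n\<bar>)))" (is "?rem \<longleftrightarrow> ?coeff")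
  proof
    assume ?rem
    then obtain K where K: "K > 0"
      "\<forall>\<^sub>F n in at_top. norm (norm_L (\<lambda>x. f x - fourier_sum n f x)) \<le> K * norm (\<psi> n)"
      by (elim landau_o.bigE)
    then obtain N where N: "\<And>n. n \<ge> N \<Longrightarrow> norm_L (\<lambda>x. f x - fourier_sum n f x) \<le> K * \<psi> n"
      using \<psi>0 norm_L_nonneg by (auto simp: eventually_at_top_linorder)
    have K0: "0 \<le> K" using K by simp
    obtain K1 N1 where 1: "K1 \<ge> 0" "\<And>n. n \<ge> N1 \<Longrightarrow> norm (fourier_coeff f (1 * int n)) * ln (real n) \<le> K1 * \<psi> n"
      using coefficients_from_remainder[OF f \<psi> _ _ K0 N, of 1] assms(4) by auto
    obtain K2 N2 where 2: "K2 \<ge> 0" "\<And>n. n \<ge> N2 \<Longrightarrow> norm (fourier_coeff f (-1 * int n)) * ln (real n) \<le> K2 * \<psi> n"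
      using coefficients_from_remainder[OF f \<psi> _ _ K0 N, of "-1"] assms(5) by auto
    have bound: "norm (fourier_coeff f n * complex_of_real (ln (real_of_int \<bar>n\<bar>)))
        \<le> (K1 + K2) * norm (complex_of_real (\<psi> (nat \<bar>n\<bar>)))" if n: "\<bar>n\<bar> \<ge> int (max 1 (max N1 N2))" for n
    proof -
      define k where "k = nat \<bar>n\<bar>"
      have k: "k \<ge> 1" "k \<ge> N1" "k \<ge> N2" and kn: "real_of_int \<bar>n\<bar> = real k" using n by (auto simp: k_def)
      have "norm (fourier_coeff f n) * ln (real k) \<le> K1 * \<psi> k + K2 * \<psi> k"
      proof (cases "n \<ge> 0")
        case True
        then have "n = 1 * int k" by (simp add: k_def)
        then show ?thesis using 1(2)[OF k(2)] mult_nonneg_nonneg[OF 2(1) \<psi>0[of k]] by simp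
      next
        case False
        then have "n = -1 * int k" by (simp add: k_def)
        then show ?thesis using 2(2)[OF k(3)] mult_nonneg_nonneg[OF 1(1) \<psi>0[of k]] by simp
      qed
      then show ?thesis
        unfolding norm_mult norm_of_real kn k_def[symmetric]
        using k(1) \<psi>0[of k] by (simp add: distrib_right)
    qed
    show ?coeff
    proof (rule bigoI)
      show "\<forall>\<^sub>F n in filtercomap abs at_top. norm (fourier_coeff f n * complex_of_real (ln (real_of_int \<bar>n\<bar>)))
          \<le> (K1 + K2) * norm (complex_of_real (\<psi> (nat \<bar>n\<bar>)))"
        unfolding eventually_filtercomap
        using bound eventually_ge_at_top[of "int (max 1 (max N1 N2))"] by blast
    qed
  next
    assume ?coeff
    then obtain K where K: "K > 0" "\<forall>\<^sub>F n in filtercomap abs at_top.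
        norm (fourier_coeff f n * complex_of_real (ln (real_of_int \<bar>n\<bar>))) \<le> K * norm (complex_of_real (\<psi> (nat \<bar>n\<bar>)))"
      by (elim landau_o.bigE)
    then obtain M where M: "\<And>n. \<bar>n\<bar> \<ge> M \<Longrightarrow>
        norm (fourier_coeff f n * complex_of_real (ln (real_of_int \<bar>n\<bar>))) \<le> K * norm (complex_of_real (\<psi> (nat \<bar>n\<bar>)))"
      unfolding eventually_filtercomap eventually_at_top_linorder by blast
    have bound: "norm (fourier_coeff f n) * ln (real k) \<le> K * \<psi> k"
      if "k \<ge> max 1 (nat M)" "\<bar>n\<bar> = int k" for n k
    proof -
      have kn: "real_of_int \<bar>n\<bar> = real k" "nat \<bar>n\<bar> = k" using that by auto
      have "M \<le> \<bar>n\<bar>" using that by linarith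
      from M[OF this] show ?thesis
        unfolding norm_mult norm_of_real kn using that(1) \<psi>0[of k] by simp
    qed
    have K0: "0 \<le> K" using K by simp
    obtain K' N' where "\<And>n. n \<ge> N' \<Longrightarrow> norm_L (\<lambda>x. f x - fourier_sum n f x) \<le> K' * \<psi> n"
      using remainder_from_coefficients[OF f per \<psi> assms(4,5) K0 bound bound, of "max 1 (nat M)"]
      by (metis abs_minus_cancel abs_of_nat)
    then show ?rem
      using \<psi>0 norm_L_nonneg by (intro bigoI[of _ K']) (auto simp: eventually_at_top_linorder)
  qed
  then show ?thesis unfolding \<psi>_int \<psi>_def .
qed

end
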